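(* Let $q$ be a prime power, $n\ge 3$ and $1\le d\le q$. Let $P\mathcal{U}_{n-1}\subset\mathbb{P}^n$ be a degenerate Hermitian variety of rank $n$ over $\mathbb{F}_{q^2}$ with vertex $P$, and let $V(F)\subset\mathbb{P}^n$ be an $\mathbb{F}_{q^2}$-hypersurface of degree $d$. Then $$|(P\mathcal{U}_{n-1}\cap V(F))(\mathbb{F}_{q^2})|\le \max\left\{|\mathcal{U}_{n-1}(\mathbb{F}_{q^2})|+(d-1)(q+1)q^{2n-4},\ 1+q^2M_{n-1}(d)\right\},$$ where $\mathcal{U}_{n-1}$ is a non-degenerate Hermitian variety in $\mathbb{P}^{n-1}$, $M_{n-1}(d):=\max_{V(G)}|(\mathcal{U}_{n-1}\cap V(G))(\mathbb{F}_{q^2})|$, and the maximum is taken over all $\mathbb{F}_{q^2}$-hypersurfaces $V(G)$ of degree $d$ in $\mathbb{P}^{n-1}$.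
   Context: $\mathbb{P}^n$ is projective $n$-space over $\overline{\mathbb{F}}_q$, and $X(\mathbb{F}_{q^2})$ is the set of $\mathbb{F}_{q^2}$-rational points of $X$. An $\mathbb{F}_{q^2}$-hypersurface of degree $d$ in $\mathbb{P}^n$ is the zero set $V(F)$ of a nonzero homogeneous polynomial $F\in\mathbb{F}_{q^2}[x_0,\dots,x_n]$ of degree $d$ (not necessarily irreducible or reduced). A Hermitian matrix is a nonzero $(n+1)\times(n+1)$ matrix $H=(h_{ij})$ over $\mathbb{F}_{q^2}$ with $h_{ij}=h_{ji}^q$; the Hermitian variety of $H$ is the zero set in $\mathbb{P}^n$ of $\sum_{i,j}h_{ij}x_ix_j^q$. Its rank is the rank of $H$; it is non-degenerate if the rank is $n+1$, and is then denoted $\mathcal{U}_n$ (unique up to $\mathbb{F}_{q^2}$-projective equivalence). A Hermitian variety of rank $n$ in $\mathbb{P}^n$ is, up to an $\mathbb{F}_{q^2}$-linear change of coordinates, $V(x_0^{q+1}+\dots+x_{n-1}^{q+1})$; it is a cone with vertex an $\mathbb{F}_{q^2}$-point $P$ (in these coordinates $P=[0:\dots:0:1]$) over a non-degenerate Hermitian variety $\mathcal{U}_{n-1}$ of a hyperplane not through $P$, and is denoted $P\mathcal{U}_{n-1}$. *)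

theory Defs
  imports
    "HOL-Library.Poly_Mapping"
    "HOL-Algebra.Algebraic_Closure_Type"
    "HOL-Number_Theory.Prime_Powers"
    "Jordan_Normal_Form.DL_Rank"
begin

unbundle no fps_syntax

text \<open>
  The finite field is the type \<open>'a\<close>, and its algebraic closure is \<open>'a alg_closure\<close>, with
  embedding \<open>to_ac\<close>. A point of projective \<open>n\<close>-space over the closure is the set of all its
  homogeneous coordinate vectors in \<open>carrier_vec (Suc n)\<close>; coordinates are numbered
  from \<open>0\<close> to \<open>n\<close>.
\<close>

definition proj_pt :: "'k::field vec \<Rightarrow> 'k vec set" where
  "proj_pt v = {c \<cdot>\<^sub>v v | c. c \<noteq> 0}"

definition proj_space :: "nat \<Rightarrow> 'k::field vec set set" where
  "proj_space n = {proj_pt v | v. v \<in> carrier_vec (Suc n) \<and> v \<noteq> 0\<^sub>v (Suc n)}"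

definition rational_points :: "'a::field alg_closure vec set set \<Rightarrow> 'a alg_closure vec set set" where
  "rational_points S = {P \<in> S. \<exists>v\<in>P. \<forall>i<dim_vec v. v $ i \<in> Set.range to_ac}"

text \<open>
  A polynomial in variables \<open>x\<^sub>i\<close> with \<open>i\<close> a natural number is a finitely supported map from monomials
  to coefficients, and a monomial is a finitely supported map from variables to exponents.
\<close>

type_synonym 'a mpoly = "(nat \<Rightarrow>\<^sub>0 nat) \<Rightarrow>\<^sub>0 'a"

definition nonzero_form :: "nat \<Rightarrow> nat \<Rightarrow> 'a::field mpoly \<Rightarrow> bool" where
  "nonzero_form n d F \<longleftrightarrow> F \<noteq> 0 \<and>
     (\<forall>m\<in>Poly_Mapping.keys F. Poly_Mapping.keys m \<subseteq> {..n} \<and>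
        (\<Sum>i\<in>Poly_Mapping.keys m. Poly_Mapping.lookup m i) = d)"

definition eval_ac :: "'a::field mpoly \<Rightarrow> 'a alg_closure vec \<Rightarrow> 'a alg_closure" where
  "eval_ac F v = (\<Sum>m\<in>Poly_Mapping.keys F. to_ac (Poly_Mapping.lookup F m) *
     (\<Prod>i\<in>Poly_Mapping.keys m. (v $ i) ^ Poly_Mapping.lookup m i))"

definition hypersurface :: "nat \<Rightarrow> 'a::field mpoly \<Rightarrow> 'a alg_closure vec set set" where
  "hypersurface n F = {P \<in> proj_space n. \<forall>v\<in>P. eval_ac F v = 0}"

definition hermitian_matrix :: "nat \<Rightarrow> nat \<Rightarrow> 'a::field mat \<Rightarrow> bool" where
  "hermitian_matrix q n H \<longleftrightarrow> H \<in> carrier_mat (Suc n) (Suc n) \<and> H \<noteq> 0\<^sub>m (Suc n) (Suc n) \<and>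
     (\<forall>i\<le>n. \<forall>j\<le>n. H $$ (i, j) = (H $$ (j, i)) ^ q)"

definition hermitian_variety :: "nat \<Rightarrow> nat \<Rightarrow> 'a::field mat \<Rightarrow> 'a alg_closure vec set set" where
  "hermitian_variety q n H = {P \<in> proj_space n. \<forall>v\<in>P.
     (\<Sum>i\<le>n. \<Sum>j\<le>n. to_ac (H $$ (i, j)) * v $ i * (v $ j) ^ q) = 0}"

definition hermitian_rank :: "nat \<Rightarrow> 'a::field mat \<Rightarrow> nat" where
  "hermitian_rank n H = vec_space.rank (Suc n) H"

text \<open>
  \<open>S\<close> is a cone with rational vertex \<open>P\<close>: it contains the line joining \<open>P\<close> to each of its points.
  For a Hermitian variety of rank \<open>n\<close> in projective \<open>n\<close>-space, \<open>n \<ge> 2\<close>, there is exactly one such \<open>P\<close>.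
\<close>

definition cone_vertex :: "nat \<Rightarrow> 'a::field alg_closure vec set set \<Rightarrow> 'a alg_closure vec set \<Rightarrow> bool" where
  "cone_vertex n S P \<longleftrightarrow> P \<in> rational_points S \<and>
     (\<forall>Q\<in>S. \<forall>v\<in>P. \<forall>w\<in>Q. \<forall>a b. a \<cdot>\<^sub>v v + b \<cdot>\<^sub>v w \<noteq> 0\<^sub>v (Suc n) \<longrightarrow>
        proj_pt (a \<cdot>\<^sub>v v + b \<cdot>\<^sub>v w) \<in> S)"

text \<open>
  The maximal number of rational points on a degree-\<open>d\<close> hypersurface section of the Hermitian
  variety of \<open>H\<close> in projective \<open>n\<close>-space; over a finite field the set below is finite and nonempty.
\<close>

definition max_section :: "nat \<Rightarrow> nat \<Rightarrow> nat \<Rightarrow> 'a::field mat \<Rightarrow> nat" where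
  "max_section q n d H =
     Max {card (rational_points (hermitian_variety q n H \<inter> hypersurface n G)) | G.
            nonzero_form n d G}"

end

(* All counts are made in affine cones over GF(Q), Q = q^2, where a set of N projective points becomes
   1 + (Q - 1) N vectors. Orthonormal bases reduce U to S = x_0^(q+1) + ... + x_(n-1)^(q+1) and H to the
   same S with one more, free coordinate t, the direction of the vertex. Write F = f_0 + f_1 t + ... + f_k t^k
   with f_k <> 0. If k = 0, the section is a cone over a section of U. If k = d, each line through the vertex
   meets V(F) in at most d points. Otherwise a line over a point of U meets V(F) in at most k points unless
   f_k vanishes there, and the theorem follows from two bounds: |U| <= (q+1) Q^(n-2), and f_k = S = 0 has at
   most (d-k)(q+1) Q^(n-2) solutions.
   For the second bound, a form G of degree e <= q does not vanish at some S-isotropic vector u. Choose an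
   anisotropic w orthogonal to u. On every translate of span(u, w), with coordinates (s, t), the polynomials
   G and S have the coprime leading monomials s^e and t^(q+1), hence at most e (q+1) common zeros. *)
theory Submission
  imports Defs "HOL-Number_Theory.Residues"
begin

section \<open>Spaces of coordinate functions and homogeneous polynomial functions\<close>

text \<open>The difficulty lies in 0 < k < d: where \<open>f_k\<close> vanishes on U, a line through
  the vertex may lie in V(F) and carry about Q points instead of k. This loss is affordable because
  \<open>f_k\<close> only has degree d - k. The exceptional vectors number at most
  (d-k)(q+1)Q^(n-2), the other lines cost k |U|, and (d-k) + (k-1) = d-1 is the factor in the
  theorem. The bound d \<le> q enters twice. A line in an isotropic direction u, through a vector
  not orthogonal to u, has exactly q isotropic vectors, too many for a form of degree below q on
  that line. Moreover d < Q makes a nonzero polynomial a nonzero function. So the argument can run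
  on functions, where a change of coordinates is a composition; polynomials return only to name
  hypersurfaces. Dimension arguments are replaced by cardinalities throughout. Vectors are sequences
  that vanish from N on, so \<open>vecs N\<close> lies inside \<open>vecs (Suc N)\<close> and linear
  combinations are plain lambda terms.\<close>

definition vecs :: "nat \<Rightarrow> (nat \<Rightarrow> 'a::zero) set" where
  "vecs N = {x. \<forall>i\<ge>N. x i = 0}"

lemma vecs_0: "vecs 0 = {\<lambda>_. 0}"
  by (auto simp: vecs_def)

lemma bij_betw_vecs_Suc:
  "bij_betw (\<lambda>(x, t). x(N := t)) (vecs N \<times> UNIV) (vecs (Suc N))"
  by (rule bij_betw_byWitness[where f' = "\<lambda>x. (x(N := 0), x N)"])
    (auto simp: vecs_def fun_eq_iff)

lemma finite_vecs [simp]: "finite (vecs N :: (nat \<Rightarrow> 'a::{finite, zero}) set)"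
proof (induction N)
  case (Suc N)
  then have "finite ((vecs N :: (nat \<Rightarrow> 'a) set) \<times> (UNIV :: 'a set))" by (intro finite_cartesian_product) auto
  then show ?case using bij_betw_finite[OF bij_betw_vecs_Suc] by blast
qed (simp add: vecs_0)

lemma card_vecs: "card (vecs N :: (nat \<Rightarrow> 'a::{finite, zero}) set) = card (UNIV :: 'a set) ^ N"
proof (induction N)
  case (Suc N)
  show ?case
    using bij_betw_same_card[OF bij_betw_vecs_Suc[of N, where 'a = 'a]] Suc
    by (simp add: card_cartesian_product mult.commute)
qed (simp add: vecs_0)

lemma vecs_add_scaled:
  "x \<in> vecs N \<Longrightarrow> y \<in> vecs N \<Longrightarrow> (\<lambda>i. x i + c * y i :: 'a::semiring_0) \<in> vecs N"
  by (auto simp: vecs_def)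

text \<open>Double counting of the pairs (x, i) with x + v_i in Z: translation by a fixed v_i
  permutes the space, so every i occurs in exactly \<open>card Z\<close> pairs.\<close>

lemma card_translates_le:
  fixes Z :: "(nat \<Rightarrow> 'a::{finite, ring}) set"
  assumes "Z \<subseteq> vecs N" and "finite I" and v: "\<And>i. i \<in> I \<Longrightarrow> v i \<in> vecs N"
    and le: "\<And>x. x \<in> vecs N \<Longrightarrow> card {i \<in> I. (\<lambda>l. x l + v i l) \<in> Z} \<le> k"
  shows "card Z * card I \<le> card (UNIV :: 'a set) ^ N * k"
proof -
  have *: "card {x \<in> vecs N. (\<lambda>l. x l + v i l) \<in> Z} = card Z" if "i \<in> I" for i
    by (rule bij_betw_same_card[where f = "\<lambda>x l. x l + v i l"],
        rule bij_betw_byWitness[where f' = "\<lambda>x l. x l - v i l"])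
      (use v[OF that] \<open>Z \<subseteq> vecs N\<close> in \<open>auto simp: vecs_def\<close>)
  have "card Z * card I = (\<Sum>i\<in>I. card Z)" by simp
  also have "\<dots> = (\<Sum>x\<in>vecs N. card {i \<in> I. (\<lambda>l. x l + v i l) \<in> Z})"
    by (rule sum_multicount_gen[symmetric]) (use * \<open>finite I\<close> in auto)
  also have "\<dots> \<le> (\<Sum>x\<in>(vecs N :: (nat \<Rightarrow> 'a) set). k)"
    by (rule sum_mono) (rule le)
  finally show ?thesis by (simp add: card_vecs)
qed

text \<open>The degree is a label of the derivation, not an invariant of the function: over a field
  of order Q, x_0 and x_0^Q are the same function. The rule \<open>zero\<close> provides the zero
  function in every degree, as needed for vanishing coefficients in expansions.\<close>

inductive form_fun :: "nat \<Rightarrow> nat \<Rightarrow> ((nat \<Rightarrow> 'a::comm_ring_1) \<Rightarrow> 'a) \<Rightarrow> bool" for N where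
  const: "form_fun N 0 (\<lambda>x. c)"
| zero: "form_fun N d (\<lambda>x. 0)"
| add: "form_fun N d f \<Longrightarrow> form_fun N d g \<Longrightarrow> form_fun N d (\<lambda>x. f x + g x)"
| var_mult: "i < N \<Longrightarrow> form_fun N d f \<Longrightarrow> form_fun N (Suc d) (\<lambda>x. x i * f x)"

lemma form_fun_cong: "form_fun N d f \<Longrightarrow> (\<And>x. f x = g x) \<Longrightarrow> form_fun N d g"
  by (subgoal_tac "f = g") auto

lemma form_fun_scale: "form_fun N d f \<Longrightarrow> form_fun N d (\<lambda>x. c * f x)"
proof (induction rule: form_fun.induct)
  case (var_mult i d f)
  from form_fun.var_mult[OF this(1,3)] show ?case
    by (rule form_fun_cong) (simp add: algebra_simps)
qed (auto simp: distrib_left intro: form_fun.intros)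

lemma form_fun_sum: "(\<And>i. i \<in> A \<Longrightarrow> form_fun N d (f i)) \<Longrightarrow> form_fun N d (\<lambda>x. \<Sum>i\<in>A. f i x)"
  by (induction A rule: infinite_finite_induct) (auto intro: form_fun.intros)

lemma form_fun_homogeneous: "form_fun N d f \<Longrightarrow> f (\<lambda>i. c * x i) = c ^ d * f x"
  by (induction rule: form_fun.induct) (auto simp: algebra_simps)

lemma form_fun_subst:
  "form_fun N d f \<Longrightarrow> form_fun M d (\<lambda>x. f (\<lambda>l. \<Sum>j<M. x j * b j l))"
proof (induction rule: form_fun.induct)
  case (var_mult i d f)
  have "form_fun M (Suc d) (\<lambda>x. \<Sum>j<M. b j i * (x j * f (\<lambda>l. \<Sum>j<M. x j * b j l)))"
    by (intro form_fun_sum form_fun_scale form_fun.var_mult var_mult) auto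
  then show ?case
    by (rule form_fun_cong) (simp add: sum_distrib_right algebra_simps)
qed (auto intro: form_fun.intros)

text \<open>Taylor expansion along the direction p. Total homogeneity in (x, t) leaves degree d - k
  for the coefficient of t^k, so the top coefficient is constant.\<close>

lemma form_fun_expand:
  assumes "form_fun N d f"
  obtains g where "\<And>k. form_fun N (d - k) (g k)"
    and "\<And>x t. f (\<lambda>i. x i + t * p i) = (\<Sum>k\<le>d. g k x * t ^ k)"
    and "\<And>x. g d x = f p"
proof -
  \<comment> \<open>For k > d the truncated d - k is 0 and would allow an arbitrary constant as
    \<open>g k\<close>. The induction therefore also carries that these coefficients are zero;
    otherwise x_i * g_(d+1) would spoil the degree in the case \<open>var_mult\<close>.\<close>
  from assms have "\<exists>g. (\<forall>k. form_fun N (d - k) (g k)) \<and> (\<forall>k>d. g k = (\<lambda>x. 0)) \<and>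
    (\<forall>x t. f (\<lambda>i. x i + t * p i) = (\<Sum>k\<le>d. g k x * t ^ k))"
  proof (induction rule: form_fun.induct)
    case (const c)
    show ?case
      by (rule exI[of _ "\<lambda>k x. if k = 0 then c else 0"]) (auto intro: form_fun.intros)
  next
    case (zero d)
    show ?case
      by (rule exI[of _ "\<lambda>k x. 0"]) (auto intro: form_fun.intros)
  next
    case (add d f f')
    then obtain g g' where "\<forall>k. form_fun N (d - k) (g k)" "\<forall>k>d. g k = (\<lambda>x. 0)"
      "\<forall>x t. f (\<lambda>i. x i + t * p i) = (\<Sum>k\<le>d. g k x * t ^ k)"
      "\<forall>k. form_fun N (d - k) (g' k)" "\<forall>k>d. g' k = (\<lambda>x. 0)"
      "\<forall>x t. f' (\<lambda>i. x i + t * p i) = (\<Sum>k\<le>d. g' k x * t ^ k)"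
      by blast
    then show ?case
      by (intro exI[of _ "\<lambda>k x. g k x + g' k x"])
        (auto intro: form_fun.intros simp: sum.distrib algebra_simps)
  next
    case (var_mult i d f)
    then obtain g where g: "\<And>k. form_fun N (d - k) (g k)" "\<And>k. k > d \<Longrightarrow> g k = (\<lambda>x. 0)"
      "\<And>x t. f (\<lambda>i. x i + t * p i) = (\<Sum>k\<le>d. g k x * t ^ k)"
      by blast
    \<comment> \<open>Coefficients of the product of x_i + t p_i with the expansion of f.\<close>
    define h where "h k x = x i * g k x + (if k = 0 then 0 else p i * g (k - 1) x)" for k x
    have "form_fun N (Suc d - k) (h k)" for k
    proof -
      have "form_fun N (Suc d - k) (\<lambda>x. x i * g k x)"
      proof (cases "k \<le> d")
        case True
        with form_fun.var_mult[OF var_mult.hyps(1) g(1)[of k]] show ?thesis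
          by (simp add: Suc_diff_le)
      qed (simp add: g(2) form_fun.zero)
      moreover have "form_fun N (Suc d - k) (\<lambda>x. if k = 0 then 0 else p i * g (k - 1) x)"
        using g(1)[of "k - 1"] by (cases k) (auto intro: form_fun.zero form_fun_scale)
      ultimately show ?thesis
        unfolding h_def by (rule form_fun.add)
    qed
    moreover have "h k = (\<lambda>x. 0)" if "k > Suc d" for k
      using that by (auto simp: h_def g(2) fun_eq_iff)
    moreover have "(x i + t * p i) * f (\<lambda>i. x i + t * p i) = (\<Sum>k\<le>Suc d. h k x * t ^ k)" for x t
    proof -
      have "(\<Sum>k\<le>Suc d. h k x * t ^ k) = (\<Sum>k\<le>Suc d. x i * g k x * t ^ k) +
          (\<Sum>k\<le>Suc d. (if k = 0 then 0 else p i * g (k - 1) x) * t ^ k)"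
        by (simp only: h_def sum.distrib distrib_right)
      also have "(\<Sum>k\<le>Suc d. x i * g k x * t ^ k) = (\<Sum>k\<le>d. x i * g k x * t ^ k)"
        using g(2)[of "Suc d"] by simp
      also have "(\<Sum>k\<le>Suc d. (if k = 0 then 0 else p i * g (k - 1) x) * t ^ k) =
          (\<Sum>k\<le>d. p i * g k x * t ^ Suc k)"
        by (subst sum.atMost_Suc_shift) simp
      finally show ?thesis
        unfolding g(3) distrib_right sum_distrib_left by (simp add: sum.distrib mult_ac)
    qed
    ultimately show ?case by (intro exI[of _ h]) auto
  qed
  then obtain g where g: "\<And>k. form_fun N (d - k) (g k)"
    "\<And>x t. f (\<lambda>i. x i + t * p i) = (\<Sum>k\<le>d. g k x * t ^ k)"
    by blast
  have at_0: "g k (\<lambda>i. 0) = 0 ^ (d - k) * g k x" for k x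
    using form_fun_homogeneous[OF g(1), of k 0 x] by simp
  have "g d x = f p" for x
  proof -
    \<comment> \<open>At x = 0 and t = 1 all coefficients of positive degree vanish, and only the
      constant top one survives.\<close>
    have "f p = (\<Sum>k\<le>d. g k (\<lambda>i. 0))" using g(2)[of "\<lambda>i. 0" 1] by simp
    also have "\<dots> = (\<Sum>k\<le>d. if k = d then g d x else 0)"
      by (intro sum.cong refl, subst at_0[of _ x]) (auto simp: power_0_left)
    finally show ?thesis by simp
  qed
  with g show ?thesis by (intro that[of g]) auto
qed

lemma card_poly_fun_roots_le:
  fixes c :: "nat \<Rightarrow> 'a::idom"
  assumes "c k \<noteq> 0" and "k \<le> n"
  shows "card {t. (\<Sum>i\<le>n. c i * t ^ i) = 0} \<le> n"
proof -
  define p where "p = (\<Sum>i\<le>n. monom (c i) i)"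
  have "(\<Sum>i\<le>n. c i * t ^ i) = poly p t" for t
    by (simp add: p_def poly_sum poly_monom)
  moreover have "coeff p k \<noteq> 0"
    using assms by (simp add: p_def coeff_sum)
  moreover have "degree p \<le> n"
    unfolding p_def by (intro degree_sum_le) (auto intro: degree_monom_le order.trans)
  ultimately show ?thesis
    using card_poly_roots_bound[of p] by fastforce
qed

text \<open>On every line in a direction \<open>p\<close> with \<open>f p \<noteq> 0\<close>, the form restricts to a polynomial of
  degree exactly \<open>d\<close>.\<close>

lemma form_fun_card_zeros_le:
  fixes f :: "(nat \<Rightarrow> 'a::{finite, field}) \<Rightarrow> 'a"
  assumes "form_fun N d f" and "p \<in> vecs N" and "f p \<noteq> 0"
  shows "card {x \<in> vecs N. f x = 0} * card (UNIV :: 'a set) \<le> card (UNIV :: 'a set) ^ N * d"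
proof (rule card_translates_le[where v = "\<lambda>t i. t * p i"])
  fix x :: "nat \<Rightarrow> 'a"
  assume "x \<in> vecs N"
  obtain g where g: "\<And>x t. f (\<lambda>i. x i + t * p i) = (\<Sum>k\<le>d. g k x * t ^ k)" "\<And>x. g d x = f p"
    using form_fun_expand[OF assms(1)] by metis
  have "card {t \<in> UNIV. (\<lambda>l. x l + t * p l) \<in> {x \<in> vecs N. f x = 0}} \<le>
      card {t. (\<Sum>k\<le>d. g k x * t ^ k) = 0}"
    by (rule card_mono) (auto simp: g(1))
  also have "\<dots> \<le> d"
    by (rule card_poly_fun_roots_le[where k = d]) (auto simp: g(2) assms(3))
  finally show "card {t \<in> UNIV. (\<lambda>l. x l + t * p l) \<in> {x \<in> vecs N. f x = 0}} \<le> d" .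
qed (use assms(2) in \<open>auto simp: vecs_def\<close>)

section \<open>Common zeros of two bivariate polynomials\<close>

text \<open>Weighting \<open>s\<close> by \<open>q + 2\<close> and \<open>t\<close> by \<open>q + 1\<close>, the leading monomials of the two equations are
  the coprime monomials \<open>s ^ e\<close> and \<open>t ^ Suc q\<close>; the functions on the zero set are therefore spanned by
  the \<open>e * Suc q\<close> monomials divisible by neither.\<close>

lemma card_common_zeros_le:
  fixes Z :: "('a::{finite, field} \<times> 'a) set"
  assumes "q \<ge> 1"
    and eq1: "\<And>s t. (s, t) \<in> Z \<Longrightarrow> s ^ e = (\<Sum>i<e. \<Sum>j\<le>e - i. a i j * (s ^ i * t ^ j))"
    and eq2: "\<And>s t. (s, t) \<in> Z \<Longrightarrow> t ^ Suc q = A * s ^ q + B * s + C * t ^ q + D * t + E"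
  shows "card Z \<le> e * Suc q"
proof -
  \<comment> \<open>\<open>R g\<close>: on Z, the function g is a combination of the e (q+1)
    monomials s^i t^j with i < e and j \<le> q. The goal is \<open>R g\<close> for every g.\<close>
  define R where "R g \<longleftrightarrow> (\<exists>c. \<forall>s t. (s, t) \<in> Z \<longrightarrow> g s t = (\<Sum>i<e. \<Sum>j\<le>q. c i j * (s ^ i * t ^ j)))"
    for g :: "'a \<Rightarrow> 'a \<Rightarrow> 'a"
  have R_cong: "R g" if "R g'" "\<And>s t. (s, t) \<in> Z \<Longrightarrow> g s t = g' s t" for g g'
    using that unfolding R_def by fastforce
  have R_0: "R (\<lambda>s t. 0)"
    unfolding R_def by (rule exI[of _ "\<lambda>i j. 0"]) auto
  have R_add: "R (\<lambda>s t. g s t + g' s t)" if "R g" "R g'" for g g'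
  proof -
    obtain c c' where "\<forall>s t. (s, t) \<in> Z \<longrightarrow> g s t = (\<Sum>i<e. \<Sum>j\<le>q. c i j * (s ^ i * t ^ j))"
      "\<forall>s t. (s, t) \<in> Z \<longrightarrow> g' s t = (\<Sum>i<e. \<Sum>j\<le>q. c' i j * (s ^ i * t ^ j))"
      using \<open>R g\<close> \<open>R g'\<close> unfolding R_def by blast
    then show ?thesis
      unfolding R_def
      by (intro exI[of _ "\<lambda>i j. c i j + c' i j"]) (auto simp: sum.distrib distrib_right)
  qed
  have R_scale: "R (\<lambda>s t. b * g s t)" if "R g" for b g
  proof -
    obtain c where "\<forall>s t. (s, t) \<in> Z \<longrightarrow> g s t = (\<Sum>i<e. \<Sum>j\<le>q. c i j * (s ^ i * t ^ j))"
      using \<open>R g\<close> unfolding R_def by blast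
    then show ?thesis
      unfolding R_def
      by (intro exI[of _ "\<lambda>i j. b * c i j"]) (auto simp: sum_distrib_left mult.assoc)
  qed
  have R_sum: "R (\<lambda>s t. \<Sum>i\<in>I. g i s t)" if "\<And>i. i \<in> I \<Longrightarrow> R (g i)" for g and I :: "'i set"
    using that by (induction I rule: infinite_finite_induct) (auto intro: R_0 R_add)
  have R_monom: "R (\<lambda>s t. s ^ i * t ^ j)" for i j
  \<comment> \<open>Both rewritings lower this weight. For i < e and i + j \<le> e, s^i t^j is
    lighter than s^e because s weighs more than t; and s^q is lighter than t^(q+1) because q (q+2) <
    (q+1)^2.\<close>
  proof (induction "(q + 2) * i + (q + 1) * j" arbitrary: i j rule: less_induct)
    case less
    consider "i < e" "j \<le> q" | "i \<ge> e" | "j \<ge> Suc q" by linarith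
    then show ?case
    proof cases
      case 1
      have "(\<Sum>i'<e. \<Sum>j'\<le>q. (if i' = i \<and> j' = j then 1 else 0) * (s ^ i' * t ^ j')) = s ^ i * t ^ j"
        for s t :: 'a
      proof -
        have "(\<Sum>i'<e. \<Sum>j'\<le>q. (if i' = i \<and> j' = j then 1 else 0) * (s ^ i' * t ^ j')) =
            (\<Sum>i'<e. \<Sum>j'\<le>q. if i' = i then if j' = j then s ^ i * t ^ j else 0 else 0)"
          by (intro sum.cong refl) auto
        also have "\<dots> = (\<Sum>i'<e. if i' = i then s ^ i * t ^ j else 0)"
          by (intro sum.cong refl) (use 1 in auto)
        finally show ?thesis using 1 by simp
      qed
      then show ?thesis
        unfolding R_def by (intro exI[of _ "\<lambda>i' j'. if i' = i \<and> j' = j then 1 else 0"]) auto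
    next
      case 2
      have "R (\<lambda>s t. \<Sum>i'<e. \<Sum>j'\<le>e - i'. a i' j' * (s ^ (i - e + i') * t ^ (j + j')))"
      proof (intro R_sum R_scale less)
        fix i' j' assume "i' \<in> {..<e}" "j' \<in> {..e - i'}"
        then have i': "i' < e" "i' + j' \<le> e" by auto
        then have "(q + 1) * (i' + j') + i' < (q + 1) * e + e"
          by (intro add_le_less_mono mult_le_mono2) auto
        moreover have "(q + 2) * (i - e) + (q + 2) * e = (q + 2) * i"
          using 2 by (simp flip: add_mult_distrib2)
        ultimately show "(q + 2) * (i - e + i') + (q + 1) * (j + j') < (q + 2) * i + (q + 1) * j"
          by (simp add: algebra_simps)
      qed
      then show ?thesis
      proof (rule R_cong)
        fix s t assume "(s, t) \<in> Z"
        have "s ^ i * t ^ j = s ^ e * (s ^ (i - e) * t ^ j)"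
          using 2 by (simp add: power_add[symmetric])
        also have "\<dots> = (\<Sum>i'<e. \<Sum>j'\<le>e - i'. a i' j' * (s ^ (i - e + i') * t ^ (j + j')))"
          unfolding eq1[OF \<open>(s, t) \<in> Z\<close>] sum_distrib_right
          by (simp add: power_add mult_ac)
        finally show "s ^ i * t ^ j = \<dots>" .
      qed
    next
      case 3
      define k where "k = j - Suc q"
      have j: "j = k + Suc q" using 3 by (simp add: k_def)
      have "Suc 0 < q + q * q" using \<open>q \<ge> 1\<close> by (cases q) auto
      have "R (\<lambda>s t. s ^ (i + q) * t ^ k)" "R (\<lambda>s t. s ^ (i + 1) * t ^ k)"
        "R (\<lambda>s t. s ^ i * t ^ (k + q))" "R (\<lambda>s t. s ^ i * t ^ (k + 1))" "R (\<lambda>s t. s ^ i * t ^ k)"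
        by (rule less; use \<open>q \<ge> 1\<close> \<open>Suc 0 < q + q * q\<close> in \<open>simp add: j algebra_simps\<close>)+
      then have "R (\<lambda>s t. A * (s ^ (i + q) * t ^ k) + B * (s ^ (i + 1) * t ^ k) +
        C * (s ^ i * t ^ (k + q)) + D * (s ^ i * t ^ (k + 1)) + E * (s ^ i * t ^ k))"
        by (intro R_add R_scale)
      then show ?thesis
      proof (rule R_cong)
        fix s t assume "(s, t) \<in> Z"
        have "s ^ i * t ^ j = s ^ i * t ^ k * t ^ Suc q"
          by (simp add: j power_add)
        then show "s ^ i * t ^ j = A * (s ^ (i + q) * t ^ k) + B * (s ^ (i + 1) * t ^ k) +
          C * (s ^ i * t ^ (k + q)) + D * (s ^ i * t ^ (k + 1)) + E * (s ^ i * t ^ k)"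
          unfolding eq2[OF \<open>(s, t) \<in> Z\<close>] by (simp add: power_add algebra_simps)
      qed
    qed
  qed
  have R_poly: "R (\<lambda>s t. poly p s * poly r t)" for p r
  proof -
    have "R (\<lambda>s t. \<Sum>i\<le>degree p. \<Sum>j\<le>degree r. (coeff p i * coeff r j) * (s ^ i * t ^ j))"
      by (intro R_sum R_scale R_monom)
    then show ?thesis
      by (rule R_cong) (simp add: poly_altdef sum_product mult_ac)
  qed
  \<comment> \<open>Lagrange interpolation over the finite field: \<open>L b\<close> vanishes
    everywhere except at b, so products of such polynomials in s and t, once normalised, are the
    indicator functions of points.\<close>
  define L :: "'a \<Rightarrow> 'a poly" where "L b = (\<Prod>c\<in>UNIV - {b}. [:- c, 1:])" for b
  have L: "poly (L b) x = 0 \<longleftrightarrow> x \<noteq> b" for b x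
    by (auto simp: L_def poly_prod)
  have R_all: "R g" for g
  proof -
    have "R (\<lambda>s t. \<Sum>b\<in>UNIV. \<Sum>c\<in>UNIV.
      (g b c / (poly (L b) b * poly (L c) c)) * (poly (L b) s * poly (L c) t))"
      by (intro R_sum R_scale R_poly)
    then show ?thesis
    proof (rule R_cong)
      fix s t
      have "(\<Sum>b\<in>UNIV. \<Sum>c\<in>UNIV.
          (g b c / (poly (L b) b * poly (L c) c)) * (poly (L b) s * poly (L c) t)) =
          (\<Sum>b\<in>UNIV. \<Sum>c\<in>UNIV. if b = s then if c = t then g b c else 0 else 0)"
        by (intro sum.cong refl) (use L in auto)
      also have "\<dots> = (\<Sum>b\<in>UNIV. if b = s then g s t else 0)"
        by (intro sum.cong refl) auto
      finally show "g s t = (\<Sum>b\<in>UNIV. \<Sum>c\<in>UNIV.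
          (g b c / (poly (L b) b * poly (L c) c)) * (poly (L b) s * poly (L c) t))"
        by simp
    qed
  qed
  \<comment> \<open>Families of e (q+1) coefficients map onto all functions on Z; comparing
    cardinalities compares the exponents.\<close>
  let ?I = "{..<e} \<times> {..q}"
  have "PiE Z (\<lambda>_. UNIV :: 'a set) \<subseteq>
    (\<lambda>c. \<lambda>(s, t)\<in>Z. \<Sum>i<e. \<Sum>j\<le>q. c (i, j) * (s ^ i * t ^ j)) ` (PiE ?I (\<lambda>_. UNIV))"
  proof
    fix g assume g: "g \<in> PiE Z (\<lambda>_. UNIV :: 'a set)"
    obtain c where c: "\<forall>s t. (s, t) \<in> Z \<longrightarrow> g (s, t) = (\<Sum>i<e. \<Sum>j\<le>q. c i j * (s ^ i * t ^ j))"
      using R_all[of "\<lambda>s t. g (s, t)"] unfolding R_def by blast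
    show "g \<in> (\<lambda>c. \<lambda>(s, t)\<in>Z. \<Sum>i<e. \<Sum>j\<le>q. c (i, j) * (s ^ i * t ^ j)) ` (PiE ?I (\<lambda>_. UNIV))"
    proof (rule image_eqI)
      show "g = (\<lambda>(s, t)\<in>Z. \<Sum>i<e. \<Sum>j\<le>q. restrict (case_prod c) ?I (i, j) * (s ^ i * t ^ j))"
        using g c by (auto simp: PiE_def extensional_def restrict_def fun_eq_iff)
      show "restrict (case_prod c) ?I \<in> PiE ?I (\<lambda>_. UNIV)" by simp
    qed
  qed
  then have "card (PiE Z (\<lambda>_. UNIV :: 'a set)) \<le> card (PiE ?I (\<lambda>_. UNIV :: 'a set))"
    by (rule surj_card_le[rotated]) (auto intro: finite_PiE)
  moreover have "finite Z" by (rule finite_subset[of _ UNIV]) auto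
  ultimately have "card (UNIV :: 'a set) ^ card Z \<le> card (UNIV :: 'a set) ^ (e * Suc q)"
    by (simp add: card_PiE card_cartesian_product del: mult_Suc_right)
  moreover have "card {0, 1 :: 'a} \<le> card (UNIV :: 'a set)"
    by (rule card_mono) auto
  then have "1 < card (UNIV :: 'a set)" by simp
  ultimately show ?thesis
    by (rule power_le_imp_le_exp[rotated])
qed

section \<open>Finite fields of square order\<close>

text \<open>Pigeonhole: if no fibre exceeds k, a single fibre below k would push the total below k *
  \<open>card B\<close>.\<close>

lemma card_fibres_eq:
  assumes "finite A" "finite B" "f ` A \<subseteq> B" "card A \<ge> k * card B"
    and "\<And>c. c \<in> B \<Longrightarrow> card {t \<in> A. f t = c} \<le> k" and "c \<in> B"
  shows "card {t \<in> A. f t = c} = k"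
proof (rule ccontr)
  assume "card {t \<in> A. f t = c} \<noteq> k"
  then have less: "card {t \<in> A. f t = c} < k"
    using assms(5)[OF \<open>c \<in> B\<close>] by simp
  have "A = (\<Union>b\<in>B. {t \<in> A. f t = b})" using assms(3) by auto
  then have "card A = card (\<Union>b\<in>B. {t \<in> A. f t = b})" by simp
  also have "\<dots> \<le> (\<Sum>b\<in>B. card {t \<in> A. f t = b})"
    by (rule card_UN_le) (use assms in auto)
  also have "\<dots> < (\<Sum>b\<in>B. k)"
    by (rule sum_strict_mono_ex1) (use assms less in auto)
  finally show False using assms(4) by (simp add: mult.commute)
qed

locale quadratic_field =
  fixes q :: nat and K :: "'a::{finite, field} itself"
  assumes primepow_q: "primepow q"
    and card_field: "card (UNIV :: 'a set) = q ^ 2"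
begin

lemma q_ge_2: "q \<ge> 2"
  using primepow_gt_Suc_0[OF primepow_q] by simp

lemma frob_add: "(x + y :: 'a) ^ q = x ^ q + y ^ q"
proof -
  obtain p k where p: "prime p" "k > 0" "q = p ^ k"
    using primepow_q by (auto simp: primepow_def)
  have "prime CHAR('a)"
    by (rule prime_CHAR_semidom) (simp add: finite_imp_CHAR_pos)
  moreover from this have "CHAR('a) = p"
    using CHAR_dvd_CARD[where 'a = 'a] p prime_dvd_power primes_dvd_imp_eq
    by (metis card_field)
  ultimately show ?thesis
    using p freshmans_dream' by blast
qed

lemma frob_sum: "(\<Sum>i\<in>A. f i :: 'a) ^ q = (\<Sum>i\<in>A. f i ^ q)"
  using q_ge_2 by (induction A rule: infinite_finite_induct) (auto simp: frob_add)

lemma frob_minus: "(- x :: 'a) ^ q = - (x ^ q)"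
proof -
  have "x ^ q + (- x) ^ q = 0"
    using frob_add[of x "- x"] q_ge_2 by (simp add: power_0_left)
  then show ?thesis by (simp add: eq_neg_iff_add_eq_0 add.commute)
qed

lemma power_card_minus_1:
  assumes "(x :: 'a) \<noteq> 0"
  shows "x ^ (q ^ 2 - 1) = 1"
proof -
  have "bij_betw ((*) x) (UNIV - {0}) (UNIV - {0})"
    by (rule bij_betw_byWitness[where f' = "\<lambda>y. y / x"]) (use assms in auto)
  then have "(\<Prod>y\<in>UNIV - {0}. y) = (\<Prod>y\<in>UNIV - {0}. x * y)"
    by (rule prod.reindex_bij_betw[of "(*) x" _ _ "\<lambda>y. y", symmetric])
  also have "\<dots> = x ^ (q ^ 2 - 1) * (\<Prod>y\<in>UNIV - {0}. y)"
    by (simp add: prod.distrib card_field card_Diff_singleton)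
  finally show ?thesis by simp
qed

lemma frob_frob: "((x :: 'a) ^ q) ^ q = x"
proof (cases "x = 0")
  case False
  have "(x ^ q) ^ q = x ^ (Suc (q ^ 2 - 1))"
    using q_ge_2 by (simp add: power2_eq_square flip: power_mult)
  also have "\<dots> = x"
    using power_card_minus_1[OF False] by simp
  finally show ?thesis .
qed (use q_ge_2 in auto)

lemma frob_norm: "((x :: 'a) ^ Suc q) ^ q = x ^ Suc q"
  by (simp add: power_mult_distrib frob_frob)

lemma card_norm_fibre_le: "card {t :: 'a. t ^ Suc q = c} \<le> Suc q"
proof -
  let ?p = "monom 1 (Suc q) + [:- c:] :: 'a poly"
  have "degree ?p = Suc q"
    by (rule degree_add_eq_left[THEN trans]) (auto simp: degree_monom_eq)
  moreover from this have "?p \<noteq> 0" by auto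
  ultimately show ?thesis
    using card_poly_roots_bound[of ?p] by (simp add: poly_monom)
qed

lemma card_fixed_le: "card {c :: 'a. c ^ q = c} \<le> q"
proof -
  let ?p = "monom 1 q + [:0, - 1:] :: 'a poly"
  have "degree ?p = q"
    by (rule degree_add_eq_left[THEN trans]) (use q_ge_2 in \<open>auto simp: degree_monom_eq\<close>)
  moreover from this have "?p \<noteq> 0" using q_ge_2 by auto
  ultimately show ?thesis
    using card_poly_roots_bound[of ?p] by (simp add: poly_monom)
qed

text \<open>The norm and the trace have fibres of full size by \<open>card_fibres_eq\<close>: no fibre exceeds the
  degree of the polynomial defining it, and the base, being fixed by Frobenius, has at most \<open>q\<close> elements.\<close>

lemma card_norm_fibre:
  assumes "c ^ q = c" and "c \<noteq> (0 :: 'a)"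
  shows "card {t :: 'a. t ^ Suc q = c} = Suc q"
proof -
  let ?A = "UNIV - {0 :: 'a}" and ?B = "{c :: 'a. c ^ q = c} - {0}"
  have "card ?B \<le> q - 1"
    using card_fixed_le q_ge_2 by (subst card_Diff_singleton) auto
  moreover have "Suc q * (q - 1) = card ?A"
    by (simp add: card_Diff_singleton card_field power2_eq_square algebra_simps)
  ultimately have "card ?A \<ge> Suc q * card ?B"
    by (metis mult_le_mono2)
  moreover have "(\<lambda>t. t ^ Suc q) ` ?A \<subseteq> ?B"
    using frob_norm by auto
  moreover have eq: "{t \<in> ?A. t ^ Suc q = b} = {t. t ^ Suc q = b}" if "b \<in> ?B" for b
    using that by auto
  ultimately show ?thesis
    using card_fibres_eq[of ?A ?B "\<lambda>t. t ^ Suc q" "Suc q" c] card_norm_fibre_le assms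
    by (simp add: eq)
qed

lemma ex_norm:
  assumes "c ^ q = c" and "c \<noteq> (0 :: 'a)"
  obtains t :: 'a where "t ^ Suc q = c"
proof -
  have "{t :: 'a. t ^ Suc q = c} \<noteq> {}"
    using card_norm_fibre[OF assms] by (metis card.empty nat.distinct(1))
  then show ?thesis using that by auto
qed

text \<open>The left side is the trace of t b^q to the subfield of order q. It appears in this shape
  as the cross terms of a Hermitian norm along a line, b being the product of base point and
  direction.\<close>

lemma card_trace_fibre_le:
  assumes "b \<noteq> (0 :: 'a)"
  shows "card {t :: 'a. t ^ q * b + t * b ^ q = c} \<le> q"
proof -
  let ?p = "monom b q + [:- c, b ^ q:] :: 'a poly"
  have "degree ?p = q"
    by (rule degree_add_eq_left[THEN trans]) (use q_ge_2 assms in \<open>auto simp: degree_monom_eq\<close>)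
  moreover from this have "?p \<noteq> 0" using q_ge_2 by auto
  moreover have "poly ?p t = 0 \<longleftrightarrow> t ^ q * b + t * b ^ q = c" for t
    by (simp add: poly_monom algebra_simps eq_neg_iff_add_eq_0)
  ultimately show ?thesis
    using card_poly_roots_bound[of ?p] by simp
qed

lemma card_trace_fibre:
  assumes "b \<noteq> (0 :: 'a)" and "c ^ q = c"
  shows "card {t :: 'a. t ^ q * b + t * b ^ q = c} = q"
proof -
  let ?B = "{c :: 'a. c ^ q = c}"
  have "q * card ?B \<le> card (UNIV :: 'a set)"
    using card_fixed_le by (simp add: card_field power2_eq_square)
  moreover have "range (\<lambda>t. t ^ q * b + t * b ^ q) \<subseteq> ?B"
    by (auto simp: frob_add power_mult_distrib frob_frob add.commute)
  ultimately show ?thesis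
    using card_fibres_eq[of UNIV ?B "\<lambda>t. t ^ q * b + t * b ^ q" q c]
      card_trace_fibre_le[OF assms(1)] assms(2) by simp
qed

text \<open>Serves to combine two isotropic vectors with product b \<noteq> 0 into an anisotropic
  one: the norm of x + t y is then exactly this trace.\<close>

lemma ex_trace_nonzero:
  assumes "b \<noteq> (0 :: 'a)"
  obtains t :: 'a where "t ^ q * b + t * b ^ q \<noteq> 0"
proof -
  have "{t :: 'a. t ^ q * b + t * b ^ q = 0} \<noteq> UNIV"
  proof
    assume "{t :: 'a. t ^ q * b + t * b ^ q = 0} = UNIV"
    then have "q ^ 2 \<le> q"
      using card_trace_fibre_le[OF assms, of 0] by (simp add: card_field)
    then show False using q_ge_2 by (simp add: power2_eq_square)
  qed
  then show ?thesis using that by blast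
qed

end

section \<open>Hermitian forms over a finite field\<close>

text \<open>Linearity is stated as being a form of degree 1, so that additivity comes from
  \<open>form_fun_expand\<close> and the size of a hyperplane from
  \<open>form_fun_card_zeros_le\<close>.\<close>

locale hermitian_form = quadratic_field q K
  for q :: nat and K :: "'a::{finite, field} itself" +
  fixes N :: nat and B :: "(nat \<Rightarrow> 'a) \<Rightarrow> (nat \<Rightarrow> 'a) \<Rightarrow> 'a"
  assumes linear: "form_fun N 1 (\<lambda>x. B x y)"
    and conj: "B y x = B x y ^ q"
begin

lemma add_left: "B (\<lambda>i. x i + c * y i) z = B x z + c * B y z"
proof -
  obtain g where g: "\<And>x c. B (\<lambda>i. x i + c * y i) z = (\<Sum>k\<le>1. g k x * c ^ k)"
    "\<And>x. g 1 x = B y z"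
    by (rule form_fun_expand[OF linear[of z], of y]) blast
  show ?thesis using g(1)[of x 0] g(1)[of x c] g(2)[of x] by simp
qed

lemma add_right: "B z (\<lambda>i. x i + c * y i) = B z x + c ^ q * B z y"
  by (simp add: conj[of z] add_left frob_add power_mult_distrib)

lemma zero_left: "B (\<lambda>_. 0) z = 0"
  using form_fun_homogeneous[OF linear[of z], of 0 "\<lambda>_. 0"] by simp

lemma scale_left: "B (\<lambda>i. c * x i) z = c * B x z"
  using add_left[of "\<lambda>_. 0" c x z] by (simp add: zero_left)

lemma scale_right: "B z (\<lambda>i. c * x i) = c ^ q * B z x"
  by (simp add: conj[of z] scale_left power_mult_distrib)

lemma sum_left: "B (\<lambda>l. \<Sum>j\<in>J. c j * b j l) z = (\<Sum>j\<in>J. c j * B (b j) z)"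
proof (induction J rule: infinite_finite_induct)
  case (insert j J)
  then show ?case
    using add_left[of "\<lambda>l. \<Sum>j\<in>J. c j * b j l" "c j" "b j" z] by (simp add: add.commute)
qed (auto simp: zero_left)

lemma sum_right: "B z (\<lambda>l. \<Sum>j\<in>J. c j * b j l) = (\<Sum>j\<in>J. c j ^ q * B z (b j))"
  by (simp add: conj[of z] sum_left frob_sum power_mult_distrib)

lemma norm_add:
  "B (\<lambda>i. x i + c * y i) (\<lambda>i. x i + c * y i) =
    B x x + c ^ q * B x y + c * B x y ^ q + c ^ Suc q * B y y"
  by (simp add: add_left add_right conj[of y x] algebra_simps)

lemma norm_fixed: "B x x ^ q = B x x"
  using conj[of x x] by simp

text \<open>If \<open>G\<close> vanished on all isotropic vectors, it would vanish off the hyperplane orthogonal to any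
  isotropic \<open>u\<close>: a line \<open>z + K u\<close> outside it has \<open>q\<close> isotropic points, while \<open>G\<close> has degree below
  \<open>q\<close> on the line because \<open>G u = 0\<close>.\<close>

lemma ex_isotropic_not_zero:
  assumes G: "form_fun N e G" and e: "1 \<le> e" "e \<le> q"
    and p: "p \<in> vecs N" "G p \<noteq> 0"
    and u: "u \<in> vecs N" "B u u = 0" and z: "z \<in> vecs N" "B z u \<noteq> 0"
  shows "\<exists>v\<in>vecs N. B v v = 0 \<and> G v \<noteq> 0"
proof (rule ccontr)
  assume "\<not> ?thesis"
  then have vanish: "G v = 0" if "v \<in> vecs N" "B v v = 0" for v
    using that by blast
  have G_0: "G x = 0" if x: "x \<in> vecs N" "B x u \<noteq> 0" for x
  proof (rule ccontr)
    assume "G x \<noteq> 0"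
    obtain g where g: "\<And>x t. G (\<lambda>i. x i + t * u i) = (\<Sum>k\<le>e. g k x * t ^ k)"
      "\<And>x. g e x = G u"
      using form_fun_expand[OF G] by metis
    have expand: "G (\<lambda>i. x i + t * u i) = (\<Sum>k\<le>e - 1. g k x * t ^ k)" for t
      using e vanish[OF u] g(2)[of x] by (cases e) (auto simp: g(1))
    \<comment> \<open>The parameters t for which x + t u is isotropic. Since u is isotropic, the
      term t^(q+1) drops out and a trace equation remains, whose right side is fixed by
      Frobenius.\<close>
    let ?T = "{t. t ^ q * B x u + t * B x u ^ q = - B x x}"
    have "card ?T = q"
      using card_trace_fibre[OF x(2)] by (simp add: frob_minus norm_fixed)
    moreover have "?T \<subseteq> {t. (\<Sum>k\<le>e - 1. g k x * t ^ k) = 0}"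
    proof
      fix t assume "t \<in> ?T"
      then have "B (\<lambda>i. x i + t * u i) (\<lambda>i. x i + t * u i) = 0"
        by (simp add: norm_add u(2) add.assoc)
      then have "G (\<lambda>i. x i + t * u i) = 0"
        using vanish[OF vecs_add_scaled[OF x(1) u(1)]] by blast
      then show "t \<in> {t. (\<Sum>k\<le>e - 1. g k x * t ^ k) = 0}"
        unfolding expand by blast
    qed
    moreover have "g 0 x \<noteq> 0"
      using \<open>G x \<noteq> 0\<close> expand[of 0] by simp
    then have "card {t. (\<Sum>k\<le>e - 1. g k x * t ^ k) = 0} \<le> e - 1"
      by (rule card_poly_fun_roots_le) simp
    ultimately have "q \<le> e - 1"
      using card_mono[of "{t. (\<Sum>k\<le>e - 1. g k x * t ^ k) = 0}" ?T] by simp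
    then show False using e by simp
  qed
  \<comment> \<open>The zeros of G and the hyperplane orthogonal to u now cover the space. They have
    at most e Q^(N-1) and Q^(N-1) elements, so Q \<le> e + 1 \<le> q + 1, contrary to Q =
    q^2.\<close>
  let ?Q = "card (UNIV :: 'a set)" and ?A = "{x \<in> vecs N. G x = 0}" and ?L = "{x \<in> vecs N. B x u = 0}"
  have "?Q ^ N = card (vecs N :: (nat \<Rightarrow> 'a) set)" by (simp add: card_vecs)
  also have "vecs N = ?A \<union> ?L" using G_0 by auto
  also have "card (?A \<union> ?L) \<le> card ?A + card ?L" by (rule card_Un_le)
  finally have "?Q ^ N * ?Q \<le> card ?A * ?Q + card ?L * ?Q"
    by (simp flip: distrib_right)
  also have "\<dots> \<le> ?Q ^ N * (e + 1)"
    using form_fun_card_zeros_le[OF G p] form_fun_card_zeros_le[OF linear z] by simp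
  finally have "?Q \<le> e + 1"
    unfolding mult_le_cancel1 using q_ge_2 by (simp add: card_field)
  moreover have "q + q \<le> q * q" using q_ge_2 by (metis mult_2 mult_le_mono1)
  ultimately show False
    using e q_ge_2 by (simp add: card_field power2_eq_square)
qed

text \<open>Average over the translates of the plane spanned by \<open>u\<close> and \<open>w\<close>. On each of them
  \<open>card_common_zeros_le\<close> applies: \<open>G\<close> has leading monomial \<open>s ^ e\<close> because \<open>G u \<noteq> 0\<close>, and the
  Hermitian form restricts to \<open>t ^ Suc q\<close> plus additive terms.\<close>

lemma card_isotropic_zeros_le:
  assumes G: "form_fun N e G" and u: "u \<in> vecs N" "B u u = 0" "G u \<noteq> 0"
    and w: "w \<in> vecs N" "B w u = 0" "B w w \<noteq> 0"
  shows "card {x \<in> vecs N. B x x = 0 \<and> G x = 0} * card (UNIV :: 'a set) ^ 2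
    \<le> card (UNIV :: 'a set) ^ N * (e * Suc q)" (is "card ?Z * _ \<le> _")
proof -
  obtain g where g: "\<And>k. form_fun N (e - k) (g k)"
    "\<And>x s. G (\<lambda>i. x i + s * u i) = (\<Sum>k\<le>e. g k x * s ^ k)" "\<And>x. g e x = G u"
    by (rule form_fun_expand[OF G, of u]) blast
  \<comment> \<open>A second expansion, along w. The coefficient of s^i has degree at most e - i in
    t, which is the total degree bound needed for the first equation.\<close>
  have "\<exists>h. \<forall>x t. g i (\<lambda>l. x l + t * w l) = (\<Sum>j\<le>e - i. h j x * t ^ j)" for i
    using form_fun_expand[OF g(1)] by metis
  then obtain h where h: "\<And>i x t. g i (\<lambda>l. x l + t * w l) = (\<Sum>j\<le>e - i. h i j x * t ^ j)"
    by metis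
  have "card ?Z * card (UNIV :: ('a \<times> 'a) set) \<le> card (UNIV :: 'a set) ^ N * (e * Suc q)"
  proof (rule card_translates_le[where v = "\<lambda>(s, t) l. t * w l + s * u l"])
    fix x :: "nat \<Rightarrow> 'a"
    assume "x \<in> vecs N"
    define Z' where "Z' = {st. (\<lambda>l. x l + (case st of (s, t) \<Rightarrow> \<lambda>l. t * w l + s * u l) l) \<in> ?Z}"
    have Z': "B y y = 0" "G y = 0" if "(s, t) \<in> Z'" "y = (\<lambda>l. (x l + t * w l) + s * u l)" for s t y
      using that by (auto simp: Z'_def add.assoc)
    have "card Z' \<le> e * Suc q"
    proof (rule card_common_zeros_le)
      fix s t assume st: "(s, t) \<in> Z'"
      have "0 = (\<Sum>i\<le>e. (\<Sum>j\<le>e - i. h i j x * t ^ j) * s ^ i)"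
        using Z'(2)[OF st refl] unfolding g(2) h ..
      also have "\<dots> = (\<Sum>i<e. (\<Sum>j\<le>e - i. h i j x * t ^ j) * s ^ i) + G u * s ^ e"
        using h[of e x t] g(3) by (simp flip: lessThan_Suc_atMost)
      finally have "G u * s ^ e = - (\<Sum>i<e. (\<Sum>j\<le>e - i. h i j x * t ^ j) * s ^ i)"
        by (simp add: eq_neg_iff_add_eq_0 add.commute)
      then have "s ^ e = - (\<Sum>i<e. (\<Sum>j\<le>e - i. h i j x * t ^ j) * s ^ i) / G u"
        using u(3) by (simp add: field_simps)
      also have "\<dots> = (\<Sum>i<e. \<Sum>j\<le>e - i. - h i j x / G u * (s ^ i * t ^ j))"
        unfolding sum_distrib_right sum_negf[symmetric] sum_divide_distrib by (simp add: mult_ac)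
      finally show "s ^ e = \<dots>" .
      let ?y = "\<lambda>l. x l + t * w l"
      \<comment> \<open>Orthogonality of w and u excludes mixed terms in s and t, and isotropy of u
        excludes s^(q+1); hence t^(q+1) is the only monomial of degree q + 1.\<close>
      have "B ?y u = B x u" by (simp add: add_left w(2))
      then have "0 = B ?y ?y + s ^ q * B x u + s * B x u ^ q"
        using Z'(1)[OF st refl] by (simp add: norm_add[of ?y] u(2))
      then have "t ^ Suc q * B w w =
          - (B x x + t ^ q * B x w + t * B x w ^ q + s ^ q * B x u + s * B x u ^ q)"
        by (simp add: norm_add eq_neg_iff_add_eq_0 algebra_simps)
      then have "t ^ Suc q =
          - (B x x + t ^ q * B x w + t * B x w ^ q + s ^ q * B x u + s * B x u ^ q) / B w w"
        using w(3) by (simp add: field_simps)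
      also have "\<dots> = - B x u / B w w * s ^ q + - (B x u ^ q) / B w w * s +
          - B x w / B w w * t ^ q + - (B x w ^ q) / B w w * t + - B x x / B w w"
        using w(3) by (simp add: field_simps)
      finally show "t ^ Suc q = \<dots>" .
    qed (use q_ge_2 in simp)
    then show "card {st \<in> UNIV. (\<lambda>l. x l + (case st of (s, t) \<Rightarrow> \<lambda>l. t * w l + s * u l) l) \<in> ?Z}
      \<le> e * Suc q"
      by (simp add: Z'_def)
  qed (use u w in \<open>auto simp: vecs_def\<close>)
  moreover have "card (UNIV :: ('a \<times> 'a) set) = card (UNIV :: 'a set) ^ 2"
    by (simp add: power2_eq_square flip: UNIV_Times_UNIV add: card_cartesian_product)
  ultimately show ?thesis by simp
qed

end

section \<open>The standard Hermitian form\<close>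

lemma form_fun_linear: "form_fun N 1 (\<lambda>x. \<Sum>i<N. x i * c i)"
  unfolding One_nat_def by (intro form_fun_sum form_fun.var_mult form_fun.const) auto

context quadratic_field
begin

definition std_form :: "nat \<Rightarrow> (nat \<Rightarrow> 'a) \<Rightarrow> (nat \<Rightarrow> 'a) \<Rightarrow> 'a" where
  "std_form N x y = (\<Sum>i<N. x i * y i ^ q)"

lemma hermitian_form_std: "hermitian_form q N (std_form N)"
proof
  show "form_fun N 1 (\<lambda>x. std_form N x y)" for y
    unfolding std_form_def by (rule form_fun_linear)
  show "std_form N y x = std_form N x y ^ q" for x y
    by (simp add: std_form_def frob_sum power_mult_distrib frob_frob mult.commute)
qed

lemma std_form_norm: "std_form N x x = (\<Sum>i<N. x i ^ Suc q)"
  by (simp add: std_form_def)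

abbreviation unit_fun :: "nat \<Rightarrow> nat \<Rightarrow> 'a" where
  "unit_fun j \<equiv> (\<lambda>l. if l = j then 1 else 0)"

lemma std_form_unit_left: "j < N \<Longrightarrow> std_form N (unit_fun j) y = y j ^ q"
  by (simp add: std_form_def if_distrib[of "\<lambda>a. a * _"] cong: if_cong)

text \<open>The vectors \<open>w j\<close> = e_j - \<alpha>_j e_i are orthogonal to u, and N \<ge> 3
  leaves two choices j, k of the index. If both are isotropic, then 1 + \<alpha>^(q+1) = 0 makes
  \<alpha>_j and \<alpha>_k nonzero, so the two vectors have nonzero product and a suitable
  combination of them is anisotropic.\<close>

lemma ex_orthogonal_anisotropic:
  assumes "N \<ge> 3" and "i < N" and "u i \<noteq> 0"
  obtains w where "w \<in> vecs N" and "std_form N w u = 0" and "std_form N w w \<noteq> 0"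
proof -
  interpret S: hermitian_form q K N "std_form N" by (rule hermitian_form_std)
  have "card ({..<N} - {i}) \<ge> 2"
    using assms by simp
  then obtain j k where jk: "j < N" "k < N" "j \<noteq> i" "k \<noteq> i" "j \<noteq> k"
    by (auto simp: card_le_Suc_iff numeral_2_eq_2)
  define \<alpha> where "\<alpha> j = u j ^ q / u i ^ q" for j
  define w where "w j = (\<lambda>l. unit_fun j l + (- \<alpha> j) * unit_fun i l)" for j
  have w_vecs: "w j \<in> vecs N" if "j < N" for j
    using that \<open>i < N\<close> by (auto simp: w_def vecs_def)
  have w_left: "std_form N (w j) y = y j ^ q - \<alpha> j * y i ^ q" if "j < N" for j y
    unfolding w_def using that \<open>i < N\<close> by (simp only: S.add_left std_form_unit_left) simp
  have w_u: "std_form N (w j) u = 0" if "j < N" for j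
    using w_left[OF that] \<open>u i \<noteq> 0\<close> by (simp add: \<alpha>_def)
  have w_w: "std_form N (w j) (w j) = 1 + \<alpha> j ^ Suc q" if "j < N" "j \<noteq> i" for j
    using w_left[OF that(1)] that(2) by (simp add: w_def frob_minus)
  have jk_form: "std_form N (w j) (w k) = \<alpha> j * \<alpha> k ^ q"
    using w_left jk q_ge_2 by (simp add: w_def frob_minus)
  show ?thesis
  proof (cases "std_form N (w j) (w j) = 0 \<and> std_form N (w k) (w k) = 0")
    case False
    then show ?thesis using that w_vecs w_u jk by blast
  next
    case True
    then have "\<alpha> j \<noteq> 0" "\<alpha> k \<noteq> 0"
      using w_w jk by auto
    then obtain c where c: "c ^ q * (\<alpha> j * \<alpha> k ^ q) + c * (\<alpha> j * \<alpha> k ^ q) ^ q \<noteq> 0"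
      by (metis ex_trace_nonzero mult_eq_0_iff power_not_zero)
    show ?thesis
    proof (rule that)
      show "(\<lambda>l. w j l + c * w k l) \<in> vecs N"
        using w_vecs jk by (intro vecs_add_scaled)
      show "std_form N (\<lambda>l. w j l + c * w k l) u = 0"
        using w_u jk by (simp add: S.add_left)
      show "std_form N (\<lambda>l. w j l + c * w k l) (\<lambda>l. w j l + c * w k l) \<noteq> 0"
        using c True by (simp add: S.norm_add jk_form)
    qed
  qed
qed

lemma card_std_form_zeros_le:
  assumes "N \<ge> 3" and G: "form_fun N e G" "1 \<le> e" "e \<le> q" "p \<in> vecs N" "G p \<noteq> 0"
  shows "card {x \<in> vecs N. std_form N x x = 0 \<and> G x = 0} \<le> e * Suc q * (q ^ 2) ^ (N - 2)"
proof -
  interpret S: hermitian_form q K N "std_form N" by (rule hermitian_form_std)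
  \<comment> \<open>Being fixed by Frobenius, -1 is a norm, so e_0 + a e_1 is isotropic. It is not
    orthogonal to e_0, which provides the pair u, z for
    \<open>ex_isotropic_not_zero\<close>.\<close>
  have "(- 1 :: 'a) ^ q = - 1" by (simp add: frob_minus)
  then obtain a :: 'a where a: "a ^ Suc q = - 1"
    using ex_norm[of "- 1"] by auto
  define u0 where "u0 = (\<lambda>l. unit_fun 0 l + a * unit_fun 1 l)"
  have "u0 \<in> vecs N" "unit_fun 0 \<in> vecs N"
    using \<open>N \<ge> 3\<close> by (auto simp: u0_def vecs_def)
  moreover have "std_form N (unit_fun 0) u0 = 1"
    using \<open>N \<ge> 3\<close> by (simp add: std_form_unit_left u0_def)
  moreover have "std_form N u0 u0 = 0"
    unfolding u0_def using \<open>N \<ge> 3\<close> a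
    by (simp only: S.norm_add std_form_unit_left) (use q_ge_2 in \<open>simp add: power_0_left\<close>)
  ultimately obtain u where u: "u \<in> vecs N" "std_form N u u = 0" "G u \<noteq> 0"
    using S.ex_isotropic_not_zero[OF G] by fastforce
  \<comment> \<open>Since e \<ge> 1, the form G vanishes at the zero vector, so u is a nonzero
    vector.\<close>
  have "\<exists>i<N. u i \<noteq> 0"
  proof (rule ccontr)
    assume "\<not> ?thesis"
    then have "u = (\<lambda>i. 0 * u i)" using u(1) by (auto simp: vecs_def fun_eq_iff not_less)
    then have "G u = 0 ^ e * G u"
      using form_fun_homogeneous[OF G(1), of 0 u] by simp
    then show False using u(3) G(2) by (simp add: power_0_left)
  qed
  then obtain w where w: "w \<in> vecs N" "std_form N w u = 0" "std_form N w w \<noteq> 0"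
    using ex_orthogonal_anisotropic[OF \<open>N \<ge> 3\<close>] by metis
  have "N = (N - 2) + 2" using \<open>N \<ge> 3\<close> by simp
  then have "(q ^ 2) ^ N = (q ^ 2) ^ (N - 2) * (q ^ 2) ^ 2" by (metis power_add)
  with S.card_isotropic_zeros_le[OF G(1) u w] have
    "card {x \<in> vecs N. std_form N x x = 0 \<and> G x = 0} * (q ^ 2) ^ 2 \<le>
      (e * Suc q * (q ^ 2) ^ (N - 2)) * (q ^ 2) ^ 2"
    by (simp only: card_field mult_ac)
  then show ?thesis
    using q_ge_2 by (subst (asm) mult_le_cancel2) simp
qed

section \<open>The number of isotropic vectors of the standard form\<close>

definition std_zeros :: "nat \<Rightarrow> (nat \<Rightarrow> 'a) set" where
  "std_zeros N = {x \<in> vecs N. std_form N x x = 0}"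

text \<open>The last coordinate t must satisfy t^(q+1) = - S(x): one solution if x is isotropic and
  q + 1 otherwise. Moving the negative term to the left keeps the recursion free of
  subtraction.\<close>

lemma card_std_zeros_Suc:
  "card (std_zeros (Suc N)) + q * card (std_zeros N) = Suc q * (q ^ 2) ^ N"
proof -
  let ?T = "\<lambda>x. {t :: 'a. t ^ Suc q = - std_form N x x}"
  have "bij_betw (\<lambda>(x, t). x(N := t)) (SIGMA x:vecs N. ?T x) (std_zeros (Suc N))"
    unfolding bij_betw_def
  proof
    show "inj_on (\<lambda>(x, t). x(N := t)) (SIGMA x:vecs N. ?T x)"
      by (rule inj_on_subset[OF bij_betw_imp_inj_on[OF bij_betw_vecs_Suc]]) auto
    have norm: "std_form (Suc N) (x(N := t)) (x(N := t)) = std_form N x x + t ^ Suc q"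
      for x and t :: 'a
      by (simp add: std_form_norm)
    show "(\<lambda>(x, t). x(N := t)) ` (SIGMA x:vecs N. ?T x) = std_zeros (Suc N)"
    proof (intro equalityI subsetI)
      fix y assume "y \<in> (\<lambda>(x, t). x(N := t)) ` (SIGMA x:vecs N. ?T x)"
      then show "y \<in> std_zeros (Suc N)"
        using norm by (auto simp: std_zeros_def vecs_def)
    next
      fix y assume y: "y \<in> std_zeros (Suc N)"
      then have "y \<in> (\<lambda>(x, t). x(N := t)) ` (vecs N \<times> UNIV)"
        using bij_betw_imp_surj_on[OF bij_betw_vecs_Suc] by (auto simp: std_zeros_def)
      then obtain x t where xt: "x \<in> vecs N" "y = x(N := t)" by auto
      moreover have "t ^ Suc q = - std_form N x x"
        using y norm[of x t] xt(2) by (simp add: std_zeros_def eq_neg_iff_add_eq_0 add.commute)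
      ultimately show "y \<in> (\<lambda>(x, t). x(N := t)) ` (SIGMA x:vecs N. ?T x)"
        by (intro image_eqI[of _ _ "(x, t)"]) auto
    qed
  qed
  then have "card (std_zeros (Suc N)) = (\<Sum>x\<in>vecs N. card (?T x))"
    using bij_betw_same_card by fastforce
  also have "\<dots> = (\<Sum>x\<in>vecs N. if x \<in> std_zeros N then 1 else Suc q)"
  proof (rule sum.cong[OF refl])
    fix x :: "nat \<Rightarrow> 'a" assume x: "x \<in> vecs N"
    show "card (?T x) = (if x \<in> std_zeros N then 1 else Suc q)"
    proof (cases "std_form N x x = 0")
      case True
      then have "?T x = {0}" by auto
      then show ?thesis using True x by (simp add: std_zeros_def)
    next
      case False
      have "(- std_form N x x) ^ q = - std_form N x x"
        using hermitian_form.norm_fixed[OF hermitian_form_std] by (simp add: frob_minus)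
      from card_norm_fibre[OF this] show ?thesis
        using False by (simp add: std_zeros_def)
    qed
  qed
  also have "\<dots> = card (std_zeros N) + Suc q * card (vecs N - std_zeros N)"
  proof -
    have "{x \<in> vecs N. x \<in> std_zeros N} = std_zeros N"
      "{x \<in> vecs N. x \<notin> std_zeros N} = vecs N - std_zeros N"
      by (auto simp: std_zeros_def)
    then show ?thesis by (simp add: sum.If_cases Int_def)
  qed
  also have "card (vecs N - std_zeros N) = (q ^ 2) ^ N - card (std_zeros N)"
    by (subst card_Diff_subset) (auto simp: std_zeros_def card_vecs card_field)
  finally have "card (std_zeros (Suc N)) =
    card (std_zeros N) + Suc q * ((q ^ 2) ^ N - card (std_zeros N))" .
  moreover have "card (std_zeros N) \<le> (q ^ 2) ^ N"
    using card_mono[of "vecs N" "std_zeros N"] by (auto simp: std_zeros_def card_vecs card_field)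
  then obtain r where "(q ^ 2) ^ N = card (std_zeros N) + r"
    using le_Suc_ex by blast
  ultimately show ?thesis by (simp add: algebra_simps)
qed

text \<open>For N \<ge> 2 and 1 + (Q-1) u isotropic vectors this is u \<le> (q+1) Q^(N-2),
  multiplied by Q (Q-1). The recursion reverses inequalities, so the induction goes from N - 2 to
  N.\<close>

lemma card_std_zeros_le:
  assumes "N \<ge> 1"
  shows "q ^ 2 * card (std_zeros N) + Suc q * (q ^ 2) ^ (N - 1) \<le> q ^ 2 + Suc q * (q ^ 2) ^ N"
  using assms
proof (induction N rule: less_induct)
  case (less N)
  have zeros_0: "card (std_zeros 0) = 1"
    by (simp add: std_zeros_def vecs_0 std_form_def)
  then have zeros_1: "card (std_zeros 1) = 1"
    using card_std_zeros_Suc[of 0] by simp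
  then have zeros_2: "card (std_zeros 2) + q = Suc q * q ^ 2"
    using card_std_zeros_Suc[of 1] by (simp add: numeral_2_eq_2)
  consider "N = 1" | "N = 2" | "N \<ge> 3"
    using less.prems by linarith
  then show ?case
  proof cases
    case 1
    have "q ^ 2 * 1 + Suc q * 1 \<le> q ^ 2 * 1 + Suc q * q ^ 2"
      using q_ge_2 by (intro add_left_mono mult_le_mono2) simp
    then show ?thesis
      by (simp only: 1 zeros_1 diff_self_eq_0 power_0 power_one_right mult_1_right)
  next
    case 2
    have "q ^ 2 * (card (std_zeros 2) + q) = Suc q * (q ^ 2) ^ 2"
      by (simp only: zeros_2 power2_eq_square mult_ac)
    then have "q ^ 2 * card (std_zeros 2) + Suc q * q ^ 2 \<le> q ^ 2 + Suc q * (q ^ 2) ^ 2"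
      by (simp add: algebra_simps power2_eq_square)
    then show ?thesis using 2 by simp
  next
    case 3
    define m where "m = N - 3"
    define Y where "Y = (q ^ 2) ^ m"
    define z z' z'' where "z = card (std_zeros (Suc m))" and "z' = card (std_zeros (Suc (Suc m)))"
      and "z'' = card (std_zeros (Suc (Suc (Suc m))))"
    have N: "N = Suc (Suc (Suc m))" using 3 by (simp add: m_def)
    have IH: "q ^ 2 * z + Suc q * Y \<le> q ^ 2 + Suc q * (q ^ 2 * Y)"
      using less.IH[of "Suc m"] by (simp add: N z_def Y_def)
    have z': "z' + q * z = Suc q * (q ^ 2 * Y)"
      and z'': "z'' + q * z' = Suc q * (q ^ 2 * (q ^ 2 * Y))"
      unfolding z_def z'_def z''_def Y_def by (simp_all only: card_std_zeros_Suc power_Suc)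
    have "z'' + q * (z' + q * z) = Suc q * (q ^ 2 * (q ^ 2 * Y)) + q ^ 2 * z"
      using z'' by (simp add: algebra_simps power2_eq_square)
    then have eq: "z'' + q * (Suc q * (q ^ 2 * Y)) = Suc q * (q ^ 2 * (q ^ 2 * Y)) + q ^ 2 * z"
      by (simp only: z')
    have "Y \<ge> 1" using q_ge_2 by (simp add: Y_def)
    have "q ^ 4 + 2 * (Suc q * (q ^ 4 * Y)) \<le> q ^ 2 + Suc q * (q ^ 2 * Y) + q * (Suc q * (q ^ 4 * Y))"
    \<comment> \<open>For q = 2 the terms with q^4 Y cancel and 12 \<le> 12 Y remains, an equality
      at Y = 1; for q \<ge> 3 these terms leave ample room.\<close>
    proof (cases "q = 2")
      case True
      then show ?thesis using \<open>Y \<ge> 1\<close> by simp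
    next
      case False
      then have "3 * (Suc q * (q ^ 4 * Y)) \<le> q * (Suc q * (q ^ 4 * Y))"
        using q_ge_2 by (intro mult_le_mono1) simp
      moreover have "1 * (q ^ 4 * 1) \<le> Suc q * (q ^ 4 * Y)"
        using \<open>Y \<ge> 1\<close> by (intro mult_le_mono) auto
      ultimately show ?thesis by linarith
    qed
    moreover have "q ^ 2 * (q ^ 2 * z + Suc q * Y) \<le> q ^ 2 * (q ^ 2 + Suc q * (q ^ 2 * Y))"
      using IH by (rule mult_le_mono2)
    then have "q ^ 4 * z + Suc q * (q ^ 2 * Y) \<le> q ^ 4 + Suc q * (q ^ 4 * Y)"
      by (simp add: algebra_simps power2_eq_square eval_nat_numeral)
    moreover have "q ^ 2 * z'' + q * (Suc q * (q ^ 4 * Y)) = Suc q * (q ^ 6 * Y) + q ^ 4 * z"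
      using arg_cong[OF eq, of "(*) (q ^ 2)"] by (simp add: algebra_simps eval_nat_numeral)
    ultimately have "q ^ 2 * z'' + Suc q * (q ^ 4 * Y) \<le> q ^ 2 + Suc q * (q ^ 6 * Y)"
      by linarith
    then show ?thesis
      by (simp add: N z''_def Y_def algebra_simps eval_nat_numeral)
  qed
qed

end

section \<open>Orthonormal systems\<close>

context hermitian_form
begin

lemma project_left:
  "B (\<lambda>l. x l + - 1 * (\<Sum>i<k. B x (b i) * b i l)) z = B x z - (\<Sum>i<k. B x (b i) * B (b i) z)"
  unfolding add_left[of x "- 1" "\<lambda>l. \<Sum>i<k. B x (b i) * b i l"] sum_left by simp

text \<open>Gram-Schmidt, with \<open>radical\<close> as a rank condition in terms of cardinalities.
  The orthogonal complement P of b_0, ..., b_(k-1) has at least Q^(N-k) elements, too many to lie in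
  the radical, so some y in P has a nonzero product with some x. Projecting x to P does not change
  this product, and the projection, y, or a combination of both is anisotropic.\<close>

lemma ex_orthonormal:
  assumes "r \<le> N"
    and radical: "card {y \<in> vecs N. \<forall>x\<in>vecs N. B x y = 0} \<le> card (UNIV :: 'a set) ^ (N - r)"
    and "k \<le> r"
  shows "\<exists>b. (\<forall>i<k. b i \<in> vecs N) \<and> (\<forall>i<k. \<forall>j<k. B (b i) (b j) = (if i = j then 1 else 0))"
  using \<open>k \<le> r\<close>
proof (induction k)
  case (Suc k)
  then obtain b where b: "\<And>i. i < k \<Longrightarrow> b i \<in> vecs N"
    and ortho: "\<And>i j. i < k \<Longrightarrow> j < k \<Longrightarrow> B (b i) (b j) = (if i = j then 1 else 0)"
    by auto
  let ?Q = "card (UNIV :: 'a set)"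
  define P where "P = {y \<in> vecs N. \<forall>i<k. B y (b i) = 0}"
  define \<pi> where "\<pi> x = (\<lambda>l. x l + - 1 * (\<Sum>i<k. B x (b i) * b i l))" for x
  have span: "(\<lambda>l. \<Sum>i<k. c i * b i l) \<in> vecs N" for c
    using b by (auto simp: vecs_def)
  have \<pi>: "\<pi> x \<in> P" if "x \<in> vecs N" for x
  proof -
    have "(\<Sum>i<k. B x (b i) * B (b i) (b j)) = B x (b j)" if "j < k" for j
    proof -
      have "(\<Sum>i<k. B x (b i) * B (b i) (b j)) = (\<Sum>i<k. if i = j then B x (b j) else 0)"
        using ortho that by (intro sum.cong refl) auto
      then show ?thesis using that by simp
    qed
    moreover have "\<pi> x \<in> vecs N"
      unfolding \<pi>_def by (rule vecs_add_scaled[OF that span])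
    ultimately show ?thesis
      by (auto simp only: P_def \<pi>_def project_left mem_Collect_eq diff_self)
  qed
  have sub: "vecs N \<subseteq> (\<lambda>(y, c) l. y l + (\<Sum>i<k. c i * b i l)) ` (P \<times> vecs k)"
  proof
    fix x :: "nat \<Rightarrow> 'a" assume "x \<in> vecs N"
    then show "x \<in> (\<lambda>(y, c) l. y l + (\<Sum>i<k. c i * b i l)) ` (P \<times> vecs k)"
      by (intro image_eqI[of _ _ "(\<pi> x, \<lambda>i. if i < k then B x (b i) else 0)"])
        (auto simp: \<pi> vecs_def, auto simp: \<pi>_def)
  qed
  have "finite P" by (simp add: P_def)
  then have "card (vecs N :: (nat \<Rightarrow> 'a) set) \<le> card (P \<times> (vecs k :: (nat \<Rightarrow> 'a) set))"
    by (intro surj_card_le[OF _ sub] finite_cartesian_product finite_vecs)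
  then have "?Q ^ N \<le> card P * ?Q ^ k"
    by (simp add: card_cartesian_product card_vecs)
  have "?Q > 1" using q_ge_2 one_less_power[of q 2] by (simp add: card_field)
  have "\<not> P \<subseteq> {y \<in> vecs N. \<forall>x\<in>vecs N. B x y = 0}"
  proof
    assume "P \<subseteq> {y \<in> vecs N. \<forall>x\<in>vecs N. B x y = 0}"
    then have "card P \<le> ?Q ^ (N - r)"
      using radical card_mono[of "{y \<in> vecs N. \<forall>x\<in>vecs N. B x y = 0}" P] by simp
    then have "?Q ^ N \<le> ?Q ^ (N - r) * ?Q ^ k"
      using \<open>?Q ^ N \<le> card P * ?Q ^ k\<close> by (meson mult_le_mono1 le_trans)
    then have "N \<le> N - r + k"
      using \<open>?Q > 1\<close> by (simp flip: power_add)
    then show False using \<open>r \<le> N\<close> \<open>Suc k \<le> r\<close> by simp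
  qed
  then obtain x y where "y \<in> P" and x: "x \<in> vecs N" "B x y \<noteq> 0"
    by (auto simp: P_def)
  then have "B (b i) y = 0" if "i < k" for i
    using that q_ge_2 by (simp add: conj[of "b i" y] P_def)
  then have "B (\<pi> x) y \<noteq> 0"
    using x unfolding \<pi>_def project_left by simp
  then obtain c where c: "c ^ q * B (\<pi> x) y + c * B (\<pi> x) y ^ q \<noteq> 0"
    using ex_trace_nonzero by blast
  have "\<exists>v\<in>P. B v v \<noteq> 0"
  proof (cases "B (\<pi> x) (\<pi> x) = 0 \<and> B y y = 0")
    case True
    moreover have "(\<lambda>l. \<pi> x l + c * y l) \<in> P"
      using \<pi>[OF x(1)] \<open>y \<in> P\<close> by (auto simp: P_def add_left vecs_add_scaled)
    ultimately show ?thesis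
      using c by (intro bexI[of _ "\<lambda>l. \<pi> x l + c * y l"]) (auto simp: norm_add)
  qed (use \<pi>[OF x(1)] \<open>y \<in> P\<close> in blast)
  then obtain v where v: "v \<in> P" "B v v \<noteq> 0" by blast
  \<comment> \<open>B v v is fixed by Frobenius, so its inverse is a norm and v can be scaled to
    norm 1.\<close>
  obtain t where t: "t ^ Suc q = 1 / B v v"
    using ex_norm[of "1 / B v v"] v(2) norm_fixed[of v] by (auto simp: power_divide)
  define w where "w = (\<lambda>l. t * v l)"
  have "w \<in> vecs N" using v(1) by (auto simp: w_def P_def vecs_def)
  moreover have "B w w = 1"
    using t v(2) by (simp add: w_def scale_left scale_right field_simps)
  moreover have "B w (b i) = 0" if "i < k" for i
    using v(1) that by (simp add: w_def scale_left P_def)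
  moreover from this have "B (b i) w = 0" if "i < k" for i
    using that q_ge_2 by (simp add: conj[of "b i" w])
  ultimately show ?case
    using b ortho by (intro exI[of _ "b(k := w)"]) (auto simp: less_Suc_eq)
qed simp

section \<open>Coordinates with respect to an orthonormal system\<close>

lemma orthonormal_coordinate:
  fixes n :: nat
  assumes "\<And>i j. i < n \<Longrightarrow> j < n \<Longrightarrow> B (b i) (b j) = (if i = j then 1 else 0)" and "j < n"
  shows "B (\<lambda>l. \<Sum>i<n. x i * b i l) (b j) = x j"
proof -
  have "(\<Sum>i<n. x i * B (b i) (b j)) = (\<Sum>i<n. if i = j then x j else 0)"
    using assms by (intro sum.cong refl) auto
  also have "\<dots> = x j" using assms(2) by simp
  finally show ?thesis by (simp add: sum_left)
qed

lemma orthonormal_std_form: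
  fixes n :: nat
  assumes "\<And>i j. i < n \<Longrightarrow> j < n \<Longrightarrow> B (b i) (b j) = (if i = j then 1 else 0)"
  shows "B (\<lambda>l. \<Sum>i<n. x i * b i l) (\<lambda>l. \<Sum>i<n. x i * b i l) = std_form n x x"
  by (simp add: sum_right orthonormal_coordinate[OF assms] std_form_def mult.commute)

lemma bij_betw_orthonormal:
  assumes "\<And>i j. i < N \<Longrightarrow> j < N \<Longrightarrow> B (b i) (b j) = (if i = j then 1 else 0)"
    and "\<And>i. i < N \<Longrightarrow> b i \<in> vecs N"
  shows "bij_betw (\<lambda>x l. \<Sum>i<N. x i * b i l) (vecs N) (vecs N)"
proof -
  let ?T = "\<lambda>x l. \<Sum>i<N. x i * b i l"
  have "inj_on ?T (vecs N)"
  proof (rule inj_onI)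
    fix x y assume xy: "x \<in> vecs N" "y \<in> vecs N" "?T x = ?T y"
    have "x j = y j" if "j < N" for j
      using arg_cong[OF xy(3), of "\<lambda>z. B z (b j)"] that
      by (simp add: orthonormal_coordinate[OF assms(1)])
    with xy show "x = y" by (auto simp: vecs_def fun_eq_iff) (metis not_less)
  qed
  moreover have "?T ` vecs N \<subseteq> vecs N"
    using assms(2) by (auto simp: vecs_def)
  ultimately show ?thesis
    using endo_inj_surj[OF finite_vecs] by (simp add: bij_betw_def)
qed

text \<open>Products with the b_j do not see p and recover x; then p \<noteq> 0 recovers t.
  Surjectivity follows because both sides have Q^(n+1) elements.\<close>

lemma bij_betw_orthonormal_cone:
  assumes "N = Suc n"
    and "\<And>i j. i < n \<Longrightarrow> j < n \<Longrightarrow> B (b i) (b j) = (if i = j then 1 else 0)"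
    and "\<And>i. i < n \<Longrightarrow> b i \<in> vecs N"
    and p: "p \<in> vecs N" "p \<noteq> (\<lambda>_. 0)" "\<And>x. x \<in> vecs N \<Longrightarrow> B x p = 0"
  shows "bij_betw (\<lambda>(x, t) l. (\<Sum>i<n. x i * b i l) + t * p l) (vecs n \<times> UNIV) (vecs N)"
proof -
  let ?T = "\<lambda>(x, t) l. (\<Sum>i<n. x i * b i l) + t * p l"
  have "inj_on ?T (vecs n \<times> UNIV)"
  proof (rule inj_onI; clarify)
    fix x y s t assume xy: "x \<in> vecs n" "y \<in> vecs n" and
      eq: "(\<lambda>l. (\<Sum>i<n. x i * b i l) + s * p l) = (\<lambda>l. (\<Sum>i<n. y i * b i l) + t * p l)"
    have "x j = y j" if "j < n" for j
    proof -
      have "B p (b j) = 0"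
        using p(3)[OF assms(3)[OF that]] conj[of p "b j"] q_ge_2 by (simp add: power_0_left)
      then show ?thesis
        using arg_cong[OF eq, of "\<lambda>z. B z (b j)"] that
        by (simp add: add_left orthonormal_coordinate[OF assms(2)])
    qed
    with xy have "x = y" by (auto simp: vecs_def fun_eq_iff) (metis not_less)
    moreover obtain l where "p l \<noteq> 0" using p(2) by auto
    ultimately show "x = y \<and> s = t" using fun_cong[OF eq, of l] by simp
  qed
  then have "card (?T ` (vecs n \<times> UNIV)) = card (vecs N :: (nat \<Rightarrow> 'a) set)"
    using assms(1) by (subst card_image) (simp_all add: card_cartesian_product card_vecs mult.commute)
  moreover have "?T ` (vecs n \<times> UNIV) \<subseteq> vecs N"
    using assms(3) p(1) by (auto simp: vecs_def)
  ultimately have "?T ` (vecs n \<times> UNIV) = vecs N"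
    by (intro card_subset_eq finite_vecs)
  with \<open>inj_on ?T (vecs n \<times> UNIV)\<close> show ?thesis
    by (rule bij_betw_imageI)
qed

end

section \<open>The counting argument\<close>

context quadratic_field
begin

lemma card_std_points_le:
  assumes "n \<ge> 2" and "card (std_zeros n) = 1 + (q ^ 2 - 1) * u"
  shows "u \<le> Suc q * (q ^ 2) ^ (n - 2)"
proof -
  define D Y where "D = q ^ 2 - 1" and "Y = (q ^ 2) ^ (n - 2)"
  have D: "q ^ 2 = D + 1" using q_ge_2 by (simp add: D_def)
  have "D > 0" using q_ge_2 one_less_power[of q 2] by (simp add: D_def)
  have "n - 1 = Suc (n - 2)" "n = Suc (Suc (n - 2))" using assms(1) by auto
  then have "(q ^ 2) ^ (n - 1) = q ^ 2 * Y" "(q ^ 2) ^ n = q ^ 2 * (q ^ 2 * Y)"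
    unfolding Y_def using power_Suc[of "q ^ 2" "n - 2"] power_Suc[of "q ^ 2" "Suc (n - 2)"]
    by presburger+
  then have "(D + 1) * (1 + D * u) + Suc q * ((D + 1) * Y) \<le>
      (D + 1) + Suc q * ((D + 1) * ((D + 1) * Y))"
    using card_std_zeros_le[of n] assms unfolding D_def[symmetric] D by simp
  then have "(D + 1) * (D * u) \<le> (D + 1) * (D * (Suc q * Y))"
    by (simp add: algebra_simps)
  then show ?thesis
    using \<open>D > 0\<close> by (simp add: Y_def del: mult_Suc)
qed

text \<open>The numerical core, free of geometry: C, u and M stand for the points of the section,
  the points of U, and a bound for degree d sections of U. The sum over k is the restriction of F to
  the line over x.\<close>

lemma card_cone_section_le:
  fixes C u M :: nat
  assumes n: "n \<ge> 3" and d: "1 \<le> d" "d \<le> q"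
    and f: "\<And>k. form_fun n (d - k) (f k)"
    and ex: "\<exists>k\<le>d. \<exists>x\<in>vecs n. f k x \<noteq> 0"
    and C: "card {(x, t). x \<in> std_zeros n \<and> (\<Sum>k\<le>d. f k x * t ^ k) = 0} = 1 + (q ^ 2 - 1) * C"
    and u: "card (std_zeros n) = 1 + (q ^ 2 - 1) * u"
    and M: "\<And>g. form_fun n d g \<Longrightarrow> \<exists>x\<in>vecs n. g x \<noteq> 0 \<Longrightarrow>
      card {x \<in> std_zeros n. g x = 0} \<le> 1 + (q ^ 2 - 1) * M"
  shows "C \<le> max (u + (d - 1) * Suc q * (q ^ 2) ^ (n - 2)) (1 + q ^ 2 * M)"
proof -
  define D where "D = q ^ 2 - 1"
  have D: "q ^ 2 = D + 1" using q_ge_2 by (simp add: D_def)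
  have "D > 0" using q_ge_2 one_less_power[of q 2] by (simp add: D_def)
  define Y where "Y = Suc q * (q ^ 2) ^ (n - 2)"
  have uY: "u \<le> Y" unfolding Y_def using n by (intro card_std_points_le u) simp
  define cnt where "cnt x = card {t. (\<Sum>k\<le>d. f k x * t ^ k) = 0}" for x
  have "finite (std_zeros n)" by (simp add: std_zeros_def)
  have "{(x, t). x \<in> std_zeros n \<and> (\<Sum>k\<le>d. f k x * t ^ k) = 0} =
      (SIGMA x:std_zeros n. {t. (\<Sum>k\<le>d. f k x * t ^ k) = 0})"
    by auto
  then have total: "1 + D * C = (\<Sum>x\<in>std_zeros n. cnt x)"
    using C \<open>finite (std_zeros n)\<close> by (simp add: cnt_def D_def)
  have zero_mem: "(\<lambda>_. 0) \<in> std_zeros n"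
    using q_ge_2 by (simp add: std_zeros_def vecs_def std_form_def)
  have f_0: "f k (\<lambda>_. 0) = 0" if "k < d" for k
    using form_fun_homogeneous[OF f[of k], of 0 "\<lambda>_. 0"] that by (simp add: power_0_left)
  \<comment> \<open>The degree of F in t, where a coefficient counts as zero if it vanishes as a
    function on \<open>vecs n\<close>.\<close>
  define k where "k = Max {k. k \<le> d \<and> (\<exists>x\<in>vecs n. f k x \<noteq> 0)}"
  have fin: "finite {k. k \<le> d \<and> (\<exists>x\<in>vecs n. f k x \<noteq> 0)}" by simp
  have "k \<in> {k. k \<le> d \<and> (\<exists>x\<in>vecs n. f k x \<noteq> 0)}"
    unfolding k_def by (rule Max_in[OF fin]) (use ex in auto)
  then obtain p where k: "k \<le> d" and p: "p \<in> vecs n" "f k p \<noteq> 0" by auto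
  have above: "f i x = 0" if "k < i" "i \<le> d" "x \<in> vecs n" for i x
  proof (rule ccontr)
    assume "f i x \<noteq> 0"
    then have "i \<le> k" unfolding k_def by (intro Max_ge[OF fin]) (use that in auto)
    then show False using that by simp
  qed
  have trunc: "(\<Sum>i\<le>d. f i x * t ^ i) = (\<Sum>i\<le>k. f i x * t ^ i)" if "x \<in> std_zeros n" for x t
    by (rule sum.mono_neutral_right) (use k above that in \<open>auto simp: std_zeros_def\<close>)
  have cnt_le_k: "cnt x \<le> k" if "x \<in> std_zeros n" "f k x \<noteq> 0" for x
    unfolding cnt_def trunc[OF that(1)]
    by (rule card_poly_fun_roots_le[where k = k]) (use that in auto)
  have cnt_le_Q: "cnt x \<le> D + 1" for x
    unfolding cnt_def D[symmetric] card_field[symmetric] by (rule card_mono) auto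
  consider "k = d" | "k = 0" | "1 \<le> k" "k < d" using k by linarith
  then show ?thesis
  proof cases
    case 1
    have "f d x = f d p" for x
    proof -
      have const: "f d y = f d (\<lambda>_. 0)" for y
        using form_fun_homogeneous[OF f[of d], of 0 y] by simp
      show ?thesis using const[of x] const[of p] by simp
    qed
    then have nz: "f k x \<noteq> 0" for x using p 1 by metis
    \<comment> \<open>Over x = 0 lie the multiples of the vertex vector. Here f_d is a nonzero
      constant, so the vertex is off V(F) and only the zero vector counts; it accounts for the 1 in
      1 + D C.\<close>
    have "{t. (\<Sum>k\<le>d. f k (\<lambda>_. 0) * t ^ k) = 0} = {0}"
    proof -
      have "(\<Sum>k\<le>d. f k (\<lambda>_. 0) * t ^ k) = f d (\<lambda>_. 0) * t ^ d" for t
        using f_0 by (simp flip: lessThan_Suc_atMost)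
      then show ?thesis using nz d by (auto simp: 1)
    qed
    then have "cnt (\<lambda>_. 0) = 1" unfolding cnt_def by simp
    have "1 + D * C = cnt (\<lambda>_. 0) + (\<Sum>x\<in>std_zeros n - {\<lambda>_. 0}. cnt x)"
      unfolding total by (rule sum.remove) (use zero_mem \<open>finite (std_zeros n)\<close> in auto)
    also have "(\<Sum>x\<in>std_zeros n - {\<lambda>_. 0}. cnt x) \<le> (\<Sum>x\<in>std_zeros n - {\<lambda>_. 0}. d)"
      by (rule sum_mono) (use cnt_le_k nz 1 in auto)
    also have "\<dots> = d * (D * u)"
      using u zero_mem \<open>finite (std_zeros n)\<close> by (simp add: card_Diff_singleton D_def)
    finally have "D * C \<le> D * (d * u)"
      using \<open>cnt (\<lambda>_. 0) = 1\<close> by (simp add: algebra_simps)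
    then have "C \<le> d * u" using \<open>D > 0\<close> by simp
    also have "\<dots> = u + (d - 1) * u" using d by (cases d) auto
    also have "\<dots> \<le> u + (d - 1) * Y" using uY by simp
    finally show ?thesis
      unfolding Y_def mult.assoc[symmetric] by (rule max.coboundedI1)
  next
    case 2
    have "cnt x = (if f 0 x = 0 then D + 1 else 0)" if "x \<in> std_zeros n" for x
      unfolding cnt_def trunc[OF that] using 2 card_field by (simp add: D)
    then have "1 + D * C = (\<Sum>x\<in>std_zeros n. if f 0 x = 0 then D + 1 else 0)"
      unfolding total by (intro sum.cong) auto
    also have "\<dots> = (D + 1) * card {x \<in> std_zeros n. f 0 x = 0}"
      using \<open>finite (std_zeros n)\<close> by (simp add: sum.If_cases Int_def)
    also have "\<dots> \<le> (D + 1) * (1 + D * M)"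
      using M[of "f 0"] f[of 0] p 2 by (intro mult_le_mono2) (auto simp: D_def)
    finally have "D * C \<le> D * (1 + (D + 1) * M)"
      by (simp add: algebra_simps)
    then have "C \<le> 1 + (D + 1) * M"
      unfolding mult_le_cancel1 using \<open>D > 0\<close> by simp
    then show ?thesis
      unfolding D by (rule max.coboundedI2)
  next
    case 3
    define Z where "Z = {x \<in> std_zeros n. f k x = 0}"
    have Z_le: "card Z \<le> (d - k) * Y"
    proof -
      have "Z = {x \<in> vecs n. std_form n x x = 0 \<and> f k x = 0}"
        by (auto simp: Z_def std_zeros_def)
      moreover have "card {x \<in> vecs n. std_form n x x = 0 \<and> f k x = 0} \<le>
          (d - k) * Suc q * (q ^ 2) ^ (n - 2)"
        by (rule card_std_form_zeros_le[OF n f _ _ p]) (use 3 d in auto)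
      ultimately show ?thesis by (simp only: Y_def mult.assoc)
    qed
    have "(\<lambda>_. 0) \<in> Z" using zero_mem f_0 3 by (simp add: Z_def)
    moreover have "Z \<subseteq> std_zeros n" "finite Z"
      using \<open>finite (std_zeros n)\<close> by (auto simp: Z_def)
    ultimately have "card Z \<ge> 1" by (auto simp: Suc_le_eq card_gt_0_iff)
    have "1 + D * C = (\<Sum>x\<in>Z. cnt x) + (\<Sum>x\<in>std_zeros n - Z. cnt x)"
      unfolding total
      by (subst add.commute, rule sum.subset_diff) (use \<open>Z \<subseteq> _\<close> \<open>finite (std_zeros n)\<close> in auto)
    also have "\<dots> \<le> (\<Sum>x\<in>Z. D + 1) + (\<Sum>x\<in>std_zeros n - Z. k)"
      by (intro add_mono sum_mono cnt_le_Q cnt_le_k) (auto simp: Z_def)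
    also have "\<dots> = (D + 1) * card Z + k * card (std_zeros n - Z)" by simp
    finally have "1 + D * C + k * card Z \<le>
        (D + 1) * card Z + k * (card (std_zeros n - Z) + card Z)"
      by (simp add: algebra_simps)
    also have "card (std_zeros n - Z) + card Z = 1 + D * u"
      using u card_mono[OF \<open>finite (std_zeros n)\<close> \<open>Z \<subseteq> _\<close>] \<open>Z \<subseteq> _\<close> \<open>finite Z\<close>
      by (simp add: card_Diff_subset D_def)
    finally have *: "1 + D * C + k * card Z \<le> (D + 1) * card Z + k * (1 + D * u)" .
    obtain z where z: "card Z = Suc z" using \<open>card Z \<ge> 1\<close> by (cases "card Z") auto
    \<comment> \<open>Lines over Z were given Q solutions instead of k. As k \<ge> 1, subtracting
      the k solutions per vector of Z absorbs the surplus z, so the excess is at most the number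
      \<open>card Z\<close> of vectors; \<open>Z_le\<close> bounds exactly that.\<close>
    have "z \<le> k * z" using 3 by simp
    moreover have "D * C + k * z \<le> D * (card Z + k * u) + z"
      using * unfolding z by (simp add: algebra_simps)
    ultimately have "D * C \<le> D * (card Z + k * u)" by linarith
    then have "C \<le> card Z + k * u" using \<open>D > 0\<close> by simp
    also have "\<dots> = card Z + (k - 1) * u + u" using 3 by (cases k) auto
    also have "\<dots> \<le> (d - k) * Y + (k - 1) * Y + u"
      using Z_le uY by (intro add_mono mult_le_mono2) auto
    also have "\<dots> = (d - k + (k - 1)) * Y + u" by (simp only: add_mult_distrib)
    also have "d - k + (k - 1) = d - 1" using 3 by simp
    finally show ?thesis
      unfolding Y_def mult.assoc[symmetric] add.commute[of _ u] by (rule max.coboundedI1)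
  qed
qed

end

section \<open>Hermitian matrices and their radicals\<close>

text \<open>One half of rank-nullity, by counting. Choose a maximal independent set S of columns and
  one position per column of S. Kernel vectors plus arbitrary entries at these positions are
  pairwise distinct: a coincidence would be a linear relation in S.\<close>

lemma card_kernel_le:
  fixes A :: "'a::{finite, field} mat"
  assumes A: "A \<in> carrier_mat n n"
  shows "card {y \<in> vecs n. \<forall>i<n. (\<Sum>l<n. A $$ (i, l) * y l) = 0} * card (UNIV :: 'a set) ^ vec_space.rank n A
    \<le> card (UNIV :: 'a set) ^ n"
proof -
  interpret vec_space "TYPE('a)" n .
  define ker where "ker = {y \<in> vecs n. \<forall>i<n. (\<Sum>l<n. A $$ (i, l) * y l) = 0}"
  obtain S where max: "maximal S (\<lambda>T. T \<subseteq> set (cols A) \<and> lin_indpt T)"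
    using maximal_exists[of "(\<lambda>T. T \<subseteq> set (cols A) \<and> lin_indpt T)" "card (set (cols A))" "{}"]
    by (meson List.finite_set card_mono empty_iff empty_subsetI finite_lin_indpt2 rev_finite_subset)
  then have S: "S \<subseteq> set (cols A)" "lin_indpt S" by (auto simp: maximal_def)
  then have "finite S" using finite_subset by blast
  have "set (cols A) \<subseteq> carrier_vec n" using A cols_dim by blast
  then have S_dim: "S \<subseteq> carrier_vec n" using S(1) by blast
  have "\<exists>l<n. s = col A l" if "s \<in> S" for s
    using S(1) that A by (fastforce simp: cols_def)
  then obtain j where j: "\<And>s. s \<in> S \<Longrightarrow> j s < n" "\<And>s. s \<in> S \<Longrightarrow> s = col A (j s)" by metis
  \<comment> \<open>The vector with entry \<open>c s\<close> at the position chosen for the column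
    s; its image under A is the combination of S with coefficients c.\<close>
  define x where "x c l = (\<Sum>s\<in>S. if j s = l then c s else 0)" for c :: "'a vec \<Rightarrow> 'a" and l
  have "inj_on (\<lambda>(y, c) l. y l + x c l) (ker \<times> PiE S (\<lambda>_. UNIV))"
  proof (rule inj_onI; clarify)
    fix y c y' c'
    assume y: "y \<in> ker" "y' \<in> ker" and c: "c \<in> PiE S (\<lambda>_. UNIV :: 'a set)" "c' \<in> PiE S (\<lambda>_. UNIV)"
      and eq: "(\<lambda>l. y l + x c l) = (\<lambda>l. y' l + x c' l)"
    define a where "a s = c s - c' s" for s
    have diff: "x a l = y' l - y l" for l
    proof -
      have "x a l = x c l - x c' l"
        unfolding x_def a_def sum_subtractf[symmetric] by (intro sum.cong refl) auto
      also have "\<dots> = y' l - y l"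
        using fun_cong[OF eq, of l] by (simp add: algebra_simps)
      finally show ?thesis .
    qed
    have "lincomb a S = 0\<^sub>v n"
    proof (rule eq_vecI)
      fix i assume i: "i < dim_vec (0\<^sub>v n :: 'a vec)"
      have "lincomb a S $ i = (\<Sum>s\<in>S. a s * s $ i)"
        using i S_dim by (simp add: lincomb_index)
      also have "\<dots> = (\<Sum>s\<in>S. \<Sum>l<n. if j s = l then A $$ (i, l) * a s else 0)"
      proof (rule sum.cong[OF refl])
        fix s assume s: "s \<in> S"
        have "s $ i = A $$ (i, j s)"
          using j(1)[OF s] i A by (subst j(2)[OF s]) auto
        then show "a s * s $ i = (\<Sum>l<n. if j s = l then A $$ (i, l) * a s else 0)"
          using j(1)[OF s] by simp
      qed
      also have "\<dots> = (\<Sum>l<n. A $$ (i, l) * x a l)"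
        unfolding x_def sum_distrib_left by (subst sum.swap) (intro sum.cong refl, auto)
      also have "\<dots> = (\<Sum>l<n. A $$ (i, l) * y' l) - (\<Sum>l<n. A $$ (i, l) * y l)"
        by (simp add: diff right_diff_distrib sum_subtractf)
      also have "\<dots> = 0" using y i by (simp add: ker_def)
      finally show "lincomb a S $ i = 0\<^sub>v n $ i" using i by simp
    qed (use S_dim lincomb_dim[OF \<open>finite S\<close>] in simp)
    then have "a \<in> S \<rightarrow> {0}"
      using not_lindepD[OF S(2) \<open>finite S\<close> subset_refl, of a] by simp
    then have "c s = c' s" if "s \<in> S" for s using that by (auto simp: a_def)
    with c have "c = c'" by (intro PiE_ext) auto
    with eq show "y = y' \<and> c = c'" by (auto simp: fun_eq_iff)
  qed
  moreover have "(\<lambda>(y, c) l. y l + x c l) ` (ker \<times> PiE S (\<lambda>_. UNIV)) \<subseteq> vecs n"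
  proof -
    have "x c l = 0" if "n \<le> l" for c l
      unfolding x_def using j(1) that by (intro sum.neutral) fastforce
    then show ?thesis by (auto simp: ker_def vecs_def)
  qed
  ultimately have "card (ker \<times> PiE S (\<lambda>_. UNIV :: 'a set)) \<le> card (vecs n :: (nat \<Rightarrow> 'a) set)"
    by (rule card_inj_on_le) simp
  moreover have "rank A = card S" by (rule rank_card_indpt[OF A max])
  ultimately show ?thesis
    using \<open>finite S\<close> by (simp add: card_cartesian_product card_PiE card_vecs ker_def)
qed

definition mat_form :: "nat \<Rightarrow> 'a mat \<Rightarrow> nat \<Rightarrow> (nat \<Rightarrow> 'a::field) \<Rightarrow> (nat \<Rightarrow> 'a) \<Rightarrow> 'a" where
  "mat_form n H q x y = (\<Sum>i\<le>n. \<Sum>j\<le>n. H $$ (i, j) * x i * y j ^ q)"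

context quadratic_field
begin

lemma hermitian_form_mat:
  assumes H: "hermitian_matrix q n (H :: 'a mat)"
  shows "hermitian_form q (Suc n) (mat_form n H q)"
proof
  fix x y :: "nat \<Rightarrow> 'a"
  have "form_fun (Suc n) 1 (\<lambda>x. \<Sum>i<Suc n. x i * (\<Sum>j\<le>n. H $$ (i, j) * y j ^ q))"
    by (rule form_fun_linear)
  then show "form_fun (Suc n) 1 (\<lambda>x. mat_form n H q x y)"
    by (rule form_fun_cong)
      (simp only: mat_form_def lessThan_Suc_atMost sum_distrib_left mult_ac)
  have conj: "H $$ (i, j) ^ q = H $$ (j, i)" if "i \<le> n" "j \<le> n" for i j
    using H that unfolding hermitian_matrix_def by metis
  have "mat_form n H q x y ^ q = (\<Sum>i\<le>n. \<Sum>j\<le>n. H $$ (j, i) * x i ^ q * y j)"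
    unfolding mat_form_def frob_sum power_mult_distrib frob_frob
    by (intro sum.cong refl) (simp add: conj)
  also have "\<dots> = mat_form n H q y x"
    unfolding mat_form_def by (subst sum.swap) (simp add: mult_ac)
  finally show "mat_form n H q y x = mat_form n H q x y ^ q" ..
qed

lemma mat_form_unit_left:
  "i \<le> n \<Longrightarrow> mat_form n H q (unit_fun i) y = (\<Sum>j\<le>n. H $$ (i, j) * y j ^ q)"
proof -
  assume "i \<le> n"
  have "mat_form n H q (unit_fun i) y = (\<Sum>i'\<le>n. if i' = i then \<Sum>j\<le>n. H $$ (i, j) * y j ^ q else 0)"
    unfolding mat_form_def by (intro sum.cong refl) auto
  then show ?thesis using \<open>i \<le> n\<close> by simp
qed

text \<open>The second argument enters through its q-th powers, so the coordinatewise Frobenius map,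
  an involution, embeds the radical into the kernel of H.\<close>

lemma card_radical_le:
  assumes H: "hermitian_matrix q n (H :: 'a mat)"
  shows "card {y \<in> vecs (Suc n). \<forall>x\<in>vecs (Suc n). mat_form n H q x y = 0}
    \<le> card (UNIV :: 'a set) ^ (Suc n - hermitian_rank n H)" (is "card ?R \<le> _")
proof -
  let ?Q = "card (UNIV :: 'a set)"
  let ?ker = "{y \<in> vecs (Suc n). \<forall>i<Suc n. (\<Sum>l<Suc n. H $$ (i, l) * y l) = 0}"
  have H': "H \<in> carrier_mat (Suc n) (Suc n)" using H by (simp add: hermitian_matrix_def)
  interpret vec_space "TYPE('a)" "Suc n" .
  have rank: "hermitian_rank n H \<le> Suc n"
    unfolding hermitian_rank_def by (rule rank_le_nc[OF H'])
  have "card ?R \<le> card ?ker"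
  proof (rule card_inj_on_le)
    show "inj_on (\<lambda>y l. y l ^ q) ?R"
      by (rule inj_on_inverseI[of _ "\<lambda>y l. y l ^ q"]) (simp add: frob_frob)
    show "(\<lambda>y l. y l ^ q) ` ?R \<subseteq> ?ker"
    proof clarify
      fix y :: "nat \<Rightarrow> 'a" assume y: "y \<in> vecs (Suc n)" "\<forall>x\<in>vecs (Suc n). mat_form n H q x y = 0"
      have "(\<Sum>l<Suc n. H $$ (i, l) * y l ^ q) = 0" if "i < Suc n" for i
      proof -
        have "unit_fun i \<in> vecs (Suc n)" using that by (auto simp: vecs_def)
        then have "mat_form n H q (unit_fun i) y = 0" using y(2) by blast
        then show ?thesis
          using mat_form_unit_left[of i n H y] that by (simp only: lessThan_Suc_atMost less_Suc_eq_le)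
      qed
      then show "(\<lambda>l. y l ^ q) \<in> vecs (Suc n) \<and> (\<forall>i<Suc n. (\<Sum>l<Suc n. H $$ (i, l) * y l ^ q) = 0)"
        using y(1) q_ge_2 by (auto simp: vecs_def)
    qed
  qed simp
  then have "card ?R * ?Q ^ hermitian_rank n H \<le> card ?ker * ?Q ^ hermitian_rank n H"
    by (rule mult_le_mono1)
  also have "\<dots> \<le> ?Q ^ Suc n"
    using card_kernel_le[OF H'] by (simp only: hermitian_rank_def)
  also have "\<dots> = ?Q ^ (Suc n - hermitian_rank n H) * ?Q ^ hermitian_rank n H"
    using rank by (simp flip: power_add)
  finally show ?thesis
    using q_ge_2 by (simp add: card_field)
qed

text \<open>For rank n this is the vertex. It is the Frobenius conjugate of a kernel vector of H,
  since \<open>mat_form\<close> conjugates it back.\<close>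

lemma ex_radical_vector:
  assumes H: "hermitian_matrix q n (H :: 'a mat)" and "hermitian_rank n H < Suc n"
  obtains p where "p \<in> vecs (Suc n)" "p \<noteq> (\<lambda>_. 0)" "\<And>x. mat_form n H q x p = 0"
proof -
  have H': "H \<in> carrier_mat (Suc n) (Suc n)" using H by (simp add: hermitian_matrix_def)
  interpret vec_space "TYPE('a)" "Suc n" .
  have "det H = 0"
    using det_rank_iff[OF H'] assms(2) by (auto simp: hermitian_rank_def)
  then obtain v where v: "v \<in> carrier_vec (Suc n)" "v \<noteq> 0\<^sub>v (Suc n)" "H *\<^sub>v v = 0\<^sub>v (Suc n)"
    using det_0_iff_vec_prod_zero_field[OF H'] by auto
  define p where "p l = (if l \<le> n then (v $ l) ^ q else 0)" for l
  show ?thesis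
  proof (rule that)
    show "p \<in> vecs (Suc n)" by (auto simp: vecs_def p_def)
    obtain l where "l \<le> n" "v $ l \<noteq> 0" using v by (auto simp: vec_eq_iff less_Suc_eq_le)
    then show "p \<noteq> (\<lambda>_. 0)" by (auto simp: p_def fun_eq_iff)
    fix x
    have "(\<Sum>j\<le>n. H $$ (i, j) * p j ^ q) = 0" if "i \<le> n" for i
    proof -
      have "(\<Sum>j\<le>n. H $$ (i, j) * p j ^ q) = (H *\<^sub>v v) $ i"
        using H' v(1) that
        by (auto simp: p_def frob_frob scalar_prod_def atLeast0LessThan lessThan_Suc_atMost
            intro!: sum.cong)
      then show ?thesis using v(3) that by simp
    qed
    then show "mat_form n H q x p = 0"
      by (simp add: mat_form_def mult.assoc mult.left_commute[of _ "x _"] flip: sum_distrib_left)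
  qed
qed

end

section \<open>Forms, polynomials and rational points\<close>

lemma prod_keys_eq:
  fixes m :: "nat \<Rightarrow>\<^sub>0 nat"
  shows "Poly_Mapping.keys m \<subseteq> {..<N} \<Longrightarrow>
    (\<Prod>i\<in>Poly_Mapping.keys m. x i ^ Poly_Mapping.lookup m i :: 'b::comm_monoid_mult) =
    (\<Prod>i<N. x i ^ Poly_Mapping.lookup m i)"
  by (rule prod.mono_neutral_left) (auto simp: in_keys_iff)

lemma sum_keys_eq:
  fixes m :: "nat \<Rightarrow>\<^sub>0 nat"
  shows "Poly_Mapping.keys m \<subseteq> {..<N} \<Longrightarrow>
    (\<Sum>i\<in>Poly_Mapping.keys m. Poly_Mapping.lookup m i) = (\<Sum>i<N. Poly_Mapping.lookup m i)"
  by (rule sum.mono_neutral_left) (auto simp: in_keys_iff)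

section \<open>Polynomials and the functions they define\<close>

definition mpoly_fun :: "'a::field mpoly \<Rightarrow> (nat \<Rightarrow> 'a) \<Rightarrow> 'a" where
  "mpoly_fun F x = (\<Sum>m\<in>Poly_Mapping.keys F. Poly_Mapping.lookup F m *
     (\<Prod>i\<in>Poly_Mapping.keys m. x i ^ Poly_Mapping.lookup m i))"

text \<open>Unlike \<open>nonzero_form\<close>, this admits the zero polynomial, so that forms of
  one degree are closed under sums.\<close>

definition is_form :: "nat \<Rightarrow> nat \<Rightarrow> 'a::field mpoly \<Rightarrow> bool" where
  "is_form N d F \<longleftrightarrow> (\<forall>m\<in>Poly_Mapping.keys F. Poly_Mapping.keys m \<subseteq> {..<N} \<and>
     (\<Sum>i<N. Poly_Mapping.lookup m i) = d)"

lemma nonzero_form_iff: "nonzero_form n d F \<longleftrightarrow> F \<noteq> 0 \<and> is_form (Suc n) d F"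
  unfolding nonzero_form_def is_form_def lessThan_Suc_atMost[symmetric]
  by (auto simp: sum_keys_eq)

lemma mpoly_fun_superset:
  assumes "finite S" and "Poly_Mapping.keys F \<subseteq> S"
  shows "mpoly_fun F x = (\<Sum>m\<in>S. Poly_Mapping.lookup F m *
    (\<Prod>i\<in>Poly_Mapping.keys m. x i ^ Poly_Mapping.lookup m i))"
  unfolding mpoly_fun_def by (rule sum.mono_neutral_left) (use assms in \<open>auto simp: in_keys_iff\<close>)

lemma mpoly_fun_add: "mpoly_fun (F + G) x = mpoly_fun F x + mpoly_fun G x"
proof -
  let ?S = "Poly_Mapping.keys F \<union> Poly_Mapping.keys G"
  have "mpoly_fun H x = (\<Sum>m\<in>?S. Poly_Mapping.lookup H m *
      (\<Prod>i\<in>Poly_Mapping.keys m. x i ^ Poly_Mapping.lookup m i))" if "H \<in> {F, G, F + G}" for H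
    by (rule mpoly_fun_superset) (use that Poly_Mapping.keys_add[of F G] in auto)
  then show ?thesis by (simp add: lookup_add distrib_right sum.distrib)
qed

lemma mpoly_fun_0: "mpoly_fun 0 x = 0"
  by (simp add: mpoly_fun_def)

lemma mpoly_fun_single: "mpoly_fun (Poly_Mapping.single m c) x =
    c * (\<Prod>i\<in>Poly_Mapping.keys m. x i ^ Poly_Mapping.lookup m i)"
  by (simp add: mpoly_fun_def)

lemma mpoly_fun_sum: "mpoly_fun (\<Sum>i\<in>A. F i) x = (\<Sum>i\<in>A. mpoly_fun (F i) x)"
  by (induction A rule: infinite_finite_induct) (auto simp: mpoly_fun_add mpoly_fun_0)

lemma is_form_add: "is_form N d F \<Longrightarrow> is_form N d G \<Longrightarrow> is_form N d (F + G)"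
  using Poly_Mapping.keys_add[of F G] unfolding is_form_def by blast

lemma is_form_0: "is_form N d 0"
  by (simp add: is_form_def)

lemma is_form_sum: "(\<And>i. i \<in> A \<Longrightarrow> is_form N d (F i)) \<Longrightarrow> is_form N d (\<Sum>i\<in>A. F i)"
  by (induction A rule: infinite_finite_induct) (auto simp: is_form_add is_form_0)

lemma form_fun_power_mult: "i < N \<Longrightarrow> form_fun N d f \<Longrightarrow> form_fun N (k + d) (\<lambda>x. x i ^ k * f x)"
proof (induction k)
  case (Suc k)
  from form_fun.var_mult[OF Suc.prems(1) Suc.IH[OF Suc.prems]] show ?case
    by (simp add: mult.assoc)
qed simp

lemma form_fun_monomial:
  "M \<le> N \<Longrightarrow> form_fun N (\<Sum>i<M. e i) (\<lambda>x. \<Prod>i<M. x i ^ e i)"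
proof (induction M)
  case 0
  show ?case using form_fun.const[of N 1] by simp
next
  case (Suc M)
  from form_fun_power_mult[of M N _ _ "e M", OF _ Suc.IH] Suc.prems show ?case
    by (simp add: mult.commute add.commute)
qed

lemma form_fun_mpoly_fun:
  assumes "is_form N d F"
  shows "form_fun N d (mpoly_fun F)"
proof -
  have "form_fun N d (\<lambda>x. Poly_Mapping.lookup F m *
      (\<Prod>i\<in>Poly_Mapping.keys m. x i ^ Poly_Mapping.lookup m i))" if "m \<in> Poly_Mapping.keys F" for m
  proof -
    have m: "Poly_Mapping.keys m \<subseteq> {..<N}" "(\<Sum>i<N. Poly_Mapping.lookup m i) = d"
      using assms that by (auto simp: is_form_def)
    show ?thesis
      unfolding prod_keys_eq[OF m(1)] m(2)[symmetric]
      by (intro form_fun_scale form_fun_monomial) simp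
  qed
  then have "form_fun N d (\<lambda>x. mpoly_fun F x)"
    unfolding mpoly_fun_def by (rule form_fun_sum)
  then show ?thesis by simp
qed

text \<open>The maximum M_(n-1)(d) ranges over polynomials, while the counting argument produces
  functions; this is the way back.\<close>

lemma ex_mpoly_fun:
  assumes "form_fun N d f"
  shows "\<exists>F. is_form N d F \<and> mpoly_fun F = f"
  using assms
proof (induction rule: form_fun.induct)
  case (const c)
  show ?case
    by (rule exI[of _ "Poly_Mapping.single 0 c"]) (auto simp: is_form_def mpoly_fun_single)
next
  case (zero d)
  show ?case
    by (rule exI[of _ 0]) (auto simp: is_form_0 mpoly_fun_0)
next
  case (add d f g)
  then obtain F G where "is_form N d F" "mpoly_fun F = f" "is_form N d G" "mpoly_fun G = g"
    by blast
  then show ?case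
    by (intro exI[of _ "F + G"]) (auto simp: is_form_add mpoly_fun_add)
next
  case (var_mult i d f)
  then obtain F where F: "is_form N d F" "mpoly_fun F = f" by blast
  let ?x = "Poly_Mapping.single i (1 :: nat)"
  \<comment> \<open>The polynomial x_i F, written as the sum of the shifted monomials of F.\<close>
  define G where "G = (\<Sum>m\<in>Poly_Mapping.keys F. Poly_Mapping.single (m + ?x) (Poly_Mapping.lookup F m))"
  have *: "Poly_Mapping.keys (m + ?x) \<subseteq> {..<N} \<and> (\<Sum>l<N. Poly_Mapping.lookup (m + ?x) l) = Suc d \<and>
      (\<Prod>l\<in>Poly_Mapping.keys (m + ?x). x l ^ Poly_Mapping.lookup (m + ?x) l) =
      x i * (\<Prod>l\<in>Poly_Mapping.keys m. x l ^ Poly_Mapping.lookup m l)"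
    if "m \<in> Poly_Mapping.keys F" for m and x :: "nat \<Rightarrow> 'a"
  proof -
    have m: "Poly_Mapping.keys m \<subseteq> {..<N}" "(\<Sum>l<N. Poly_Mapping.lookup m l) = d"
      using F(1) that by (auto simp: is_form_def)
    have keys: "Poly_Mapping.keys (m + ?x) \<subseteq> {..<N}"
      using m(1) Poly_Mapping.keys_add[of m ?x] \<open>i < N\<close> by auto
    have single: "Poly_Mapping.lookup ?x l = (if l = i then 1 else 0)" for l
      by (simp add: lookup_single when_def)
    have "x l ^ (if l = i then 1 else 0 :: nat) = (if l = i then x i else 1)" for l
      by simp
    then have "(\<Prod>l<N. x l ^ Poly_Mapping.lookup (m + ?x) l) =
        x i * (\<Prod>l<N. x l ^ Poly_Mapping.lookup m l)"
      using \<open>i < N\<close> by (simp only: lookup_add single power_add prod.distrib) simp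
    moreover have "(\<Sum>l<N. Poly_Mapping.lookup (m + ?x) l) = Suc d"
      using \<open>i < N\<close> m(2) by (simp only: lookup_add single sum.distrib) simp
    ultimately show ?thesis
      using keys by (simp only: prod_keys_eq[OF keys] prod_keys_eq[OF m(1)])
  qed
  have "is_form N (Suc d) G"
    unfolding G_def
  proof (rule is_form_sum)
    fix m assume "m \<in> Poly_Mapping.keys F"
    from *[OF this] show "is_form N (Suc d) (Poly_Mapping.single (m + ?x) (Poly_Mapping.lookup F m))"
      unfolding is_form_def by auto
  qed
  moreover have "mpoly_fun G x = x i * mpoly_fun F x" for x
  proof -
    have "mpoly_fun G x = (\<Sum>m\<in>Poly_Mapping.keys F. Poly_Mapping.lookup F m *
        (x i * (\<Prod>l\<in>Poly_Mapping.keys m. x l ^ Poly_Mapping.lookup m l)))"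
      unfolding G_def mpoly_fun_sum mpoly_fun_single
      by (intro sum.cong refl arg_cong2[of _ _ _ _ "(*)"]) (use * in auto)
    then show ?thesis by (simp add: mpoly_fun_def sum_distrib_left mult_ac)
  qed
  ultimately show ?case using F(2) by (intro exI[of _ G]) auto
qed

text \<open>For fixed x the sum is a polynomial of degree below Q in the last variable. It has Q
  roots, so each of its coefficients vanishes, and these are sums in fewer variables. Monomials are
  abstract indices with exponents \<open>ex\<close>, so passing to a coefficient only shrinks
  M.\<close>

lemma monomials_independent:
  fixes c :: "'m \<Rightarrow> 'a::{finite, field}" and ex :: "'m \<Rightarrow> nat \<Rightarrow> nat"
  assumes "finite M" and "\<And>m i. m \<in> M \<Longrightarrow> i < N \<Longrightarrow> ex m i < card (UNIV :: 'a set)"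
    and "\<And>m m'. m \<in> M \<Longrightarrow> m' \<in> M \<Longrightarrow> (\<And>i. i < N \<Longrightarrow> ex m i = ex m' i) \<Longrightarrow> m = m'"
    and "\<And>x. x \<in> vecs N \<Longrightarrow> (\<Sum>m\<in>M. c m * (\<Prod>i<N. x i ^ ex m i)) = 0"
    and "m \<in> M"
  shows "c m = 0"
  using assms
proof (induction N arbitrary: M)
  case 0
  then have "M = {m}" by auto
  then show ?case using "0.prems"(4)[of "\<lambda>_. 0"] by (simp add: vecs_def)
next
  case (Suc N)
  let ?Q = "card (UNIV :: 'a set)"
  let ?M = "\<lambda>k. {m \<in> M. ex m N = k}"
  have "(\<Sum>m\<in>?M k. c m * (\<Prod>i<N. x i ^ ex m i)) = 0" if x: "x \<in> vecs N" and "k < ?Q" for x k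
  proof (rule ccontr)
    let ?d = "\<lambda>k. \<Sum>m\<in>?M k. c m * (\<Prod>i<N. x i ^ ex m i)"
    assume "?d k \<noteq> 0"
    then have "card {t. (\<Sum>k\<le>?Q - 1. ?d k * t ^ k) = 0} \<le> ?Q - 1"
      by (rule card_poly_fun_roots_le) (use that in simp)
    moreover have "(\<Sum>k\<le>?Q - 1. ?d k * t ^ k) = 0" for t
    proof -
      have "(\<Sum>k\<le>?Q - 1. ?d k * t ^ k) =
          (\<Sum>k\<le>?Q - 1. \<Sum>m\<in>?M k. c m * (\<Prod>i<N. x i ^ ex m i) * t ^ ex m N)"
        unfolding sum_distrib_right by (intro sum.cong refl) auto
      also have "\<dots> = (\<Sum>m\<in>M. c m * (\<Prod>i<N. x i ^ ex m i) * t ^ ex m N)"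
      proof (rule sum.group)
        show "(\<lambda>m. ex m N) ` M \<subseteq> {..?Q - 1}"
          using Suc.prems(2)[of _ N] by fastforce
      qed (use Suc.prems(1) in auto)
      also have "\<dots> = (\<Sum>m\<in>M. c m * (\<Prod>i<Suc N. (x(N := t)) i ^ ex m i))"
        by (simp add: mult.assoc)
      also have "\<dots> = 0"
        by (rule Suc.prems(4)) (use x in \<open>auto simp: vecs_def\<close>)
      finally show ?thesis .
    qed
    moreover have "?Q > 0" by (simp add: card_gt_0_iff)
    ultimately show False by simp
  qed
  note zero = this
  show ?case
  proof (rule Suc.IH[of "?M (ex m N)"])
    show "finite (?M (ex m N))" using Suc.prems(1) by simp
    show "ex m' i < ?Q" if "m' \<in> ?M (ex m N)" "i < N" for m' i
      using Suc.prems(2)[of m' i] that by simp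
    show "m1 = m2"
      if "m1 \<in> ?M (ex m N)" "m2 \<in> ?M (ex m N)" "\<And>i. i < N \<Longrightarrow> ex m1 i = ex m2 i" for m1 m2
    proof (rule Suc.prems(3))
      show "ex m1 i = ex m2 i" if "i < Suc N" for i
        using that \<open>m1 \<in> _\<close> \<open>m2 \<in> _\<close> \<open>\<And>i. i < N \<Longrightarrow> ex m1 i = ex m2 i\<close> by (cases "i = N") auto
    qed (use that in auto)
    show "(\<Sum>m\<in>?M (ex m N). c m * (\<Prod>i<N. x i ^ ex m i)) = 0" if "x \<in> vecs N" for x
      using zero[OF that] Suc.prems(2)[OF Suc.prems(5)] by simp
    show "m \<in> ?M (ex m N)" using Suc.prems(5) by simp
  qed
qed

text \<open>Every exponent is at most d < Q, so F is reduced and its monomials are independent as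
  functions.\<close>

lemma ex_mpoly_fun_nonzero:
  fixes F :: "'a::{finite, field} mpoly"
  assumes "is_form N d F" and "F \<noteq> 0" and "d < card (UNIV :: 'a set)"
  shows "\<exists>x\<in>vecs N. mpoly_fun F x \<noteq> 0"
proof (rule ccontr)
  assume zero: "\<not> ?thesis"
  have keys: "Poly_Mapping.keys m \<subseteq> {..<N}" "(\<Sum>i<N. Poly_Mapping.lookup m i) = d"
    if "m \<in> Poly_Mapping.keys F" for m
    using assms(1) that by (auto simp: is_form_def)
  obtain m where m: "m \<in> Poly_Mapping.keys F" using assms(2) by (metis ex_in_conv keys_eq_empty)
  have "Poly_Mapping.lookup F m = 0"
  proof (rule monomials_independent[OF finite_keys _ _ _ m, where ex = Poly_Mapping.lookup])
    fix m' i assume "m' \<in> Poly_Mapping.keys F" "i < N"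
    then show "Poly_Mapping.lookup m' i < card (UNIV :: 'a set)"
      using keys(2)[of m'] member_le_sum[of i "{..<N}" "Poly_Mapping.lookup m'"] assms(3) by simp
  next
    fix m1 m2 assume m: "m1 \<in> Poly_Mapping.keys F" "m2 \<in> Poly_Mapping.keys F"
      and eq: "\<And>i. i < N \<Longrightarrow> Poly_Mapping.lookup m1 i = Poly_Mapping.lookup m2 i"
    have "Poly_Mapping.lookup m1 i = Poly_Mapping.lookup m2 i" for i
    proof (cases "i < N")
      case False
      then have "i \<notin> Poly_Mapping.keys m1" "i \<notin> Poly_Mapping.keys m2"
        using keys(1)[OF m(1)] keys(1)[OF m(2)] by auto
      then show ?thesis by (simp add: in_keys_iff)
    qed (rule eq)
    then show "m1 = m2" by (rule poly_mapping_eqI)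
  next
    fix x :: "nat \<Rightarrow> 'a" assume "x \<in> vecs N"
    then have "mpoly_fun F x = 0" using zero by blast
    moreover have "mpoly_fun F x = (\<Sum>m\<in>Poly_Mapping.keys F. Poly_Mapping.lookup F m *
        (\<Prod>i<N. x i ^ Poly_Mapping.lookup m i))"
      unfolding mpoly_fun_def by (intro sum.cong refl) (simp add: prod_keys_eq keys(1))
    ultimately show "(\<Sum>m\<in>Poly_Mapping.keys F. Poly_Mapping.lookup F m *
        (\<Prod>i<N. x i ^ Poly_Mapping.lookup m i)) = 0"
      by simp
  qed
  then show False using m by (simp add: in_keys_iff)
qed

section \<open>Rational points and their coordinate vectors\<close>

definition to_ac_vec :: "nat \<Rightarrow> (nat \<Rightarrow> 'a::field) \<Rightarrow> 'a alg_closure vec" where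
  "to_ac_vec n x = vec (Suc n) (\<lambda>i. to_ac (x i))"

lemma proj_pt_scale: "c \<noteq> 0 \<Longrightarrow> proj_pt (c \<cdot>\<^sub>v v) = proj_pt v"
proof -
  assume c: "c \<noteq> 0"
  show ?thesis
  proof (intro equalityI subsetI)
    fix w assume "w \<in> proj_pt (c \<cdot>\<^sub>v v)"
    then obtain k where "w = k \<cdot>\<^sub>v (c \<cdot>\<^sub>v v)" "k \<noteq> 0" by (auto simp: proj_pt_def)
    then have "w = (k * c) \<cdot>\<^sub>v v" "k * c \<noteq> 0" using c by (simp_all add: smult_smult_assoc)
    then show "w \<in> proj_pt v" unfolding proj_pt_def by blast
  next
    fix w assume "w \<in> proj_pt v"
    then obtain k where "w = k \<cdot>\<^sub>v v" "k \<noteq> 0" by (auto simp: proj_pt_def)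
    then have "w = (k / c) \<cdot>\<^sub>v (c \<cdot>\<^sub>v v)" "k / c \<noteq> 0"
      using c by (simp_all add: smult_smult_assoc)
    then show "w \<in> proj_pt (c \<cdot>\<^sub>v v)" unfolding proj_pt_def by blast
  qed
qed

text \<open>A rational point has exactly Q - 1 coordinate vectors over the small field, because two
  of them differ by a rational scalar. S is the homogeneous condition over the closure and s its
  restriction to rational vectors; the summand 1 is the zero vector.\<close>

lemma card_rational_points:
  fixes S :: "'a::{finite, field} alg_closure vec \<Rightarrow> bool"
  assumes scale: "\<And>c v. c \<noteq> 0 \<Longrightarrow> v \<in> carrier_vec (Suc n) \<Longrightarrow> S (c \<cdot>\<^sub>v v) \<longleftrightarrow> S v"
    and S_iff: "\<And>x. S (to_ac_vec n x) \<longleftrightarrow> s x" and "s (\<lambda>_. 0)"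
  shows "card {x \<in> vecs (Suc n). s x} =
    1 + (card (UNIV :: 'a set) - 1) * card (rational_points {P \<in> proj_space n. \<forall>v\<in>P. S v})"
proof -
  define A where "A = {x \<in> vecs (Suc n). s x} - {\<lambda>_. 0}"
  define point where "point x = proj_pt (to_ac_vec n x)" for x :: "nat \<Rightarrow> 'a"
  let ?R = "rational_points {P \<in> proj_space n. \<forall>v\<in>P. S v}"
  have carrier: "to_ac_vec n x \<in> carrier_vec (Suc n)" for x :: "nat \<Rightarrow> 'a"
    by (simp add: to_ac_vec_def)
  have nonzero: "\<exists>l\<le>n. x l \<noteq> 0" if "x \<in> A" for x
  proof (rule ccontr)
    assume "\<not> ?thesis"
    then have "x i = 0" for i using that by (cases "i \<le> n") (auto simp: A_def vecs_def)
    then show False using that by (auto simp: A_def)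
  qed
  have "point ` A = ?R"
  proof (intro equalityI subsetI)
    fix P assume "P \<in> point ` A"
    then obtain x where x: "x \<in> A" "P = proj_pt (to_ac_vec n x)" by (auto simp: point_def)
    obtain l where "l \<le> n" "x l \<noteq> 0" using nonzero[OF x(1)] by blast
    then have "to_ac_vec n x \<noteq> 0\<^sub>v (Suc n)"
      by (auto simp: to_ac_vec_def vec_eq_iff intro!: exI[of _ l])
    then have "P \<in> proj_space n" using carrier x(2) by (auto simp: proj_space_def)
    moreover have "\<forall>v\<in>P. S v"
      using x scale[OF _ carrier] S_iff by (auto simp: proj_pt_def A_def)
    moreover have "to_ac_vec n x \<in> P"
      unfolding x(2) proj_pt_def by (auto intro!: exI[of _ 1])
    ultimately show "P \<in> ?R"
      unfolding rational_points_def by (auto intro!: bexI[of _ "to_ac_vec n x"] simp: to_ac_vec_def)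
  next
    fix P assume "P \<in> ?R"
    then obtain w where P: "P \<in> proj_space n" "\<forall>v\<in>P. S v" and
      w: "w \<in> P" "\<forall>i<dim_vec w. w $ i \<in> range to_ac"
      by (auto simp: rational_points_def)
    from P(1) obtain v where v: "P = proj_pt v" "v \<in> carrier_vec (Suc n)" "v \<noteq> 0\<^sub>v (Suc n)"
      by (auto simp: proj_space_def)
    with w(1) obtain c where c: "w = c \<cdot>\<^sub>v v" "c \<noteq> 0" by (auto simp: proj_pt_def)
    define x where "x i = (if i \<le> n then of_ac (w $ i) else 0)" for i
    have dim: "dim_vec w = Suc n" using c v by simp
    have w_eq: "to_ac_vec n x = w"
      by (rule eq_vecI) (use w(2) dim in \<open>auto simp: to_ac_vec_def x_def to_ac_of_ac less_Suc_eq_le\<close>)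
    obtain l where "l \<le> n" "v $ l \<noteq> 0" using v(2,3) by (auto simp: vec_eq_iff less_Suc_eq_le)
    then have "w $ l \<noteq> 0" using c v(2) by simp
    then have "x l \<noteq> 0" using w_eq \<open>l \<le> n\<close> by (auto simp: to_ac_vec_def)
    then have "x \<noteq> (\<lambda>_. 0)" by auto
    moreover have "s x" using P(2) w(1) S_iff[of x] unfolding w_eq by blast
    ultimately have "x \<in> A" by (simp add: A_def vecs_def) (simp add: x_def)
    moreover have "P = point x" unfolding point_def w_eq c(1) v(1) using proj_pt_scale[OF c(2)] by simp
    ultimately show "P \<in> point ` A" by blast
  qed
  have fibre: "card {y \<in> A. point y = point x} = card (UNIV :: 'a set) - 1" if x: "x \<in> A" for x
  proof -
    obtain l where l: "l \<le> n" "x l \<noteq> 0" using nonzero[OF x] by blast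
    have to_ac_scale: "to_ac_vec n (\<lambda>i. c * x i) = to_ac c \<cdot>\<^sub>v to_ac_vec n x" for c
      by (rule eq_vecI) (auto simp: to_ac_vec_def)
    have "{y \<in> A. point y = point x} = (\<lambda>c i. c * x i) ` (UNIV - {0})"
    proof (intro equalityI subsetI)
      fix y assume "y \<in> {y \<in> A. point y = point x}"
      then have y: "y \<in> A" "point y = point x" by auto
      have "to_ac_vec n y \<in> point y"
        unfolding point_def proj_pt_def by (auto intro!: exI[of _ 1])
      then obtain c where c: "to_ac_vec n y = c \<cdot>\<^sub>v to_ac_vec n x" "c \<noteq> 0"
        unfolding y(2) by (auto simp: point_def proj_pt_def)
      have coord: "to_ac (y i) = c * to_ac (x i)" if "i \<le> n" for i
        using arg_cong[OF c(1), of "\<lambda>v. vec_index v i"] that by (simp add: to_ac_vec_def)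
      \<comment> \<open>A priori c lies only in the closure; a coordinate where x is nonzero shows
        that it is rational.\<close>
      have c_eq: "c = to_ac (y l / x l)" using coord[OF l(1)] l(2) by simp
      have "y i = y l / x l * x i" for i
      proof (cases "i \<le> n")
        case True
        then have "to_ac (y i) = to_ac (y l / x l * x i)"
          using coord c_eq by simp
        then show ?thesis by (simp only: to_ac_eq_iff)
      qed (use x y in \<open>auto simp: A_def vecs_def\<close>)
      moreover have "y l / x l \<noteq> 0" using c(2) c_eq by auto
      ultimately show "y \<in> (\<lambda>c i. c * x i) ` (UNIV - {0})" by blast
    next
      fix y assume "y \<in> (\<lambda>c i. c * x i) ` (UNIV - {0})"
      then obtain c where c: "c \<noteq> 0" "y = (\<lambda>i. c * x i)" by auto
      have "S (to_ac_vec n y) \<longleftrightarrow> S (to_ac_vec n x)"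
        unfolding c(2) to_ac_scale by (rule scale[OF _ carrier]) (use c(1) in simp)
      then have "s y" using x by (simp add: S_iff A_def)
      moreover have "y \<noteq> (\<lambda>_. 0)" using c l(2) by (auto simp: fun_eq_iff)
      moreover have "point y = point x"
        unfolding point_def c(2) to_ac_scale by (rule proj_pt_scale) (use c in simp)
      ultimately show "y \<in> {y \<in> A. point y = point x}" using x c by (auto simp: A_def vecs_def)
    qed
    moreover have "inj_on (\<lambda>c i. c * x i) (UNIV - {0})"
      using l(2) by (auto simp: inj_on_def fun_eq_iff)
    ultimately show ?thesis by (simp add: card_image card_Diff_singleton)
  qed
  have "finite A" by (simp add: A_def)
  then have "(\<Sum>x\<in>A. 1 :: nat) = (\<Sum>P\<in>point ` A. \<Sum>x\<in>{x \<in> A. point x = P}. 1)"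
    by (rule sum.image_gen)
  then have "card A = (\<Sum>P\<in>point ` A. card {x \<in> A. point x = P})" by simp
  also have "\<dots> = (\<Sum>P\<in>point ` A. card (UNIV :: 'a set) - 1)"
    by (rule sum.cong) (auto simp: fibre)
  also have "\<dots> = (card (UNIV :: 'a set) - 1) * card ?R"
    using \<open>point ` A = ?R\<close> by simp
  finally have "card A = (card (UNIV :: 'a set) - 1) * card ?R" .
  moreover have "{x \<in> vecs (Suc n). s x} = insert (\<lambda>_. 0) A"
    using \<open>s (\<lambda>_. 0)\<close> by (auto simp: A_def vecs_def)
  moreover have "(\<lambda>_. 0) \<notin> A" by (simp add: A_def)
  ultimately show ?thesis using \<open>finite A\<close> by simp
qed

section \<open>Hermitian varieties and their hypersurface sections\<close>

definition hermitian_eval :: "nat \<Rightarrow> nat \<Rightarrow> 'a::field mat \<Rightarrow> 'a alg_closure vec \<Rightarrow> 'a alg_closure" where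
  "hermitian_eval q n H v = (\<Sum>i\<le>n. \<Sum>j\<le>n. to_ac (H $$ (i, j)) * v $ i * (v $ j) ^ q)"

lemma hermitian_eval_scale:
  "v \<in> carrier_vec (Suc n) \<Longrightarrow> hermitian_eval q n H (c \<cdot>\<^sub>v v) = c ^ Suc q * hermitian_eval q n H v"
  by (auto simp: hermitian_eval_def power_mult_distrib sum_distrib_left mult_ac intro!: sum.cong)

lemma hermitian_eval_to_ac:
  "hermitian_eval q n H (to_ac_vec n x) = to_ac (mat_form n H q x x)"
  by (auto simp: hermitian_eval_def mat_form_def to_ac_vec_def to_ac_sum intro!: sum.cong)

lemma eval_ac_scale:
  assumes "is_form (Suc n) d F" and "v \<in> carrier_vec (Suc n)"
  shows "eval_ac F (c \<cdot>\<^sub>v v) = c ^ d * eval_ac F v"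
  unfolding eval_ac_def sum_distrib_left
proof (rule sum.cong[OF refl])
  fix m assume "m \<in> Poly_Mapping.keys F"
  with assms(1) have m: "Poly_Mapping.keys m \<subseteq> {..<Suc n}" "(\<Sum>i<Suc n. Poly_Mapping.lookup m i) = d"
    by (auto simp: is_form_def)
  have "(\<Prod>i<Suc n. (c \<cdot>\<^sub>v v) $ i ^ Poly_Mapping.lookup m i) =
      (\<Prod>i<Suc n. c ^ Poly_Mapping.lookup m i * (v $ i) ^ Poly_Mapping.lookup m i)"
    using assms(2) by (intro prod.cong refl) (auto simp: power_mult_distrib)
  also have "\<dots> = c ^ d * (\<Prod>i<Suc n. (v $ i) ^ Poly_Mapping.lookup m i)"
    unfolding prod.distrib power_sum[symmetric] m(2) ..
  finally show "to_ac (Poly_Mapping.lookup F m) *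
      (\<Prod>i\<in>Poly_Mapping.keys m. (c \<cdot>\<^sub>v v) $ i ^ Poly_Mapping.lookup m i) =
      c ^ d * (to_ac (Poly_Mapping.lookup F m) *
      (\<Prod>i\<in>Poly_Mapping.keys m. (v $ i) ^ Poly_Mapping.lookup m i))"
    unfolding prod_keys_eq[OF m(1)] by (simp only: mult.left_commute)
qed

lemma eval_ac_to_ac:
  assumes "is_form (Suc n) d F"
  shows "eval_ac F (to_ac_vec n x) = to_ac (mpoly_fun F x)"
  unfolding eval_ac_def mpoly_fun_def to_ac_sum to_ac_mult to_ac_prod to_ac_power
proof (intro sum.cong refl arg_cong2[of _ _ _ _ "(*)"] prod.cong)
  fix m i assume "m \<in> Poly_Mapping.keys F" "i \<in> Poly_Mapping.keys m"
  then have "i < Suc n" using assms by (auto simp: is_form_def)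
  then show "(to_ac_vec n x $ i) ^ Poly_Mapping.lookup m i = to_ac (x i) ^ Poly_Mapping.lookup m i"
    by (simp add: to_ac_vec_def)
qed

context quadratic_field
begin

lemma card_variety:
  fixes H :: "'a mat"
  shows "card {x \<in> vecs (Suc n). mat_form n H q x x = 0} =
    1 + (q ^ 2 - 1) * card (rational_points (hermitian_variety q n H))"
  unfolding hermitian_variety_def hermitian_eval_def[symmetric] card_field[symmetric]
  by (rule card_rational_points)
    (use q_ge_2 in \<open>auto simp: hermitian_eval_scale hermitian_eval_to_ac mat_form_def\<close>)

lemma card_section:
  fixes H :: "'a mat"
  assumes "is_form (Suc n) d F" and "d \<ge> 1"
  shows "card {x \<in> vecs (Suc n). mat_form n H q x x = 0 \<and> mpoly_fun F x = 0} =
    1 + (q ^ 2 - 1) * card (rational_points (hermitian_variety q n H \<inter> hypersurface n F))"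
proof -
  have "hermitian_variety q n H \<inter> hypersurface n F =
      {P \<in> proj_space n. \<forall>v\<in>P. hermitian_eval q n H v = 0 \<and> eval_ac F v = 0}"
    by (auto simp: hermitian_variety_def hypersurface_def hermitian_eval_def)
  moreover have "mpoly_fun F (\<lambda>_. 0) = 0"
    using form_fun_homogeneous[OF form_fun_mpoly_fun[OF assms(1)], of 0 "\<lambda>_. 0"] assms(2)
    by (simp add: power_0_left)
  ultimately show ?thesis
    unfolding card_field[symmetric]
    by (simp only:, intro card_rational_points)
      (use q_ge_2 in \<open>auto simp: hermitian_eval_scale hermitian_eval_to_ac mat_form_def
        eval_ac_scale[OF assms(1)] eval_ac_to_ac[OF assms(1)]\<close>)
qed

text \<open>\<open>Max\<close> is informative only on a finite set. The sizes of the sections are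
  bounded by Q^(n+1), although G ranges over polynomials.\<close>

lemma card_section_le_max_section:
  fixes U :: "'a mat"
  assumes "nonzero_form n d G" and "d \<ge> 1"
  shows "card (rational_points (hermitian_variety q n U \<inter> hypersurface n G)) \<le> max_section q n d U"
proof -
  let ?c = "\<lambda>G. card (rational_points (hermitian_variety q n U \<inter> hypersurface n G))"
  have "?c G \<le> (q ^ 2) ^ Suc n" if "nonzero_form n d G" for G
  proof -
    have "1 \<le> q ^ 2 - 1" using q_ge_2 one_less_power[of q 2] by simp
    then have "1 * ?c G \<le> (q ^ 2 - 1) * ?c G" by (rule mult_le_mono1)
    also have "\<dots> \<le> card {x \<in> vecs (Suc n). mat_form n U q x x = 0 \<and> mpoly_fun G x = 0}"
      using card_section[of n d G U] that assms(2) by (simp add: nonzero_form_iff)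
    also have "\<dots> \<le> card (vecs (Suc n) :: (nat \<Rightarrow> 'a) set)"
      by (rule card_mono) auto
    finally show ?thesis by (simp add: card_vecs card_field)
  qed
  then have "{?c G | G. nonzero_form n d G} \<subseteq> {..(q ^ 2) ^ Suc n}" by auto
  then have "finite {?c G | G. nonzero_form n d G}" by (rule finite_subset) simp
  then show ?thesis
    unfolding max_section_def by (rule Max_ge) (use assms(1) in blast)
qed

text \<open>The inverse of the coordinate change \<open>x \<mapsto> \<Sum>i. x i b\<^sub>i\<close> is \<open>y \<mapsto> (B y b\<^sub>i)\<^sub>i\<close>, so a form in the
  orthonormal coordinates is again a form in the original ones.\<close>

lemma nondegenerate_sections:
  fixes U :: "'a mat"
  assumes U: "hermitian_matrix q n U" "hermitian_rank n U = Suc n"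
  shows "card (std_zeros (Suc n)) = 1 + (q ^ 2 - 1) * card (rational_points (hermitian_variety q n U))"
    and "\<And>g. form_fun (Suc n) d g \<Longrightarrow> \<exists>x\<in>vecs (Suc n). g x \<noteq> 0 \<Longrightarrow> d \<ge> 1 \<Longrightarrow>
      card {x \<in> std_zeros (Suc n). g x = 0} \<le> 1 + (q ^ 2 - 1) * max_section q n d U"
proof -
  interpret B: hermitian_form q K "Suc n" "mat_form n U q"
    by (rule hermitian_form_mat[OF U(1)])
  have "card {y \<in> vecs (Suc n). \<forall>x\<in>vecs (Suc n). mat_form n U q x y = 0} \<le>
      card (UNIV :: 'a set) ^ (Suc n - Suc n)"
    using card_radical_le[OF U(1)] U(2) by simp
  from B.ex_orthonormal[OF le_refl this le_refl] obtain b where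
    b: "\<And>i. i < Suc n \<Longrightarrow> b i \<in> vecs (Suc n)" and
    ortho: "\<And>i j. i < Suc n \<Longrightarrow> j < Suc n \<Longrightarrow> mat_form n U q (b i) (b j) = (if i = j then 1 else 0)"
    by metis
  define T where "T x = (\<lambda>l. \<Sum>i<Suc n. x i * b i l)" for x :: "nat \<Rightarrow> 'a"
  have bij: "bij_betw T (vecs (Suc n)) (vecs (Suc n))"
    unfolding T_def by (rule B.bij_betw_orthonormal[OF ortho b])
  have T_norm: "mat_form n U q (T x) (T x) = std_form (Suc n) x x" for x
    unfolding T_def by (rule B.orthonormal_std_form[OF ortho])
  \<comment> \<open>The trivial condition R gives the size of the variety, and the vanishing of a
    polynomial gives a hypersurface section.\<close>
  have transport: "card {x \<in> std_zeros (Suc n). R (T x)} =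
      card {y \<in> vecs (Suc n). mat_form n U q y y = 0 \<and> R y}" for R
  proof (rule bij_betw_same_card)
    show "bij_betw T {x \<in> std_zeros (Suc n). R (T x)}
      {y \<in> vecs (Suc n). mat_form n U q y y = 0 \<and> R y}"
      unfolding bij_betw_def
    proof
      show "inj_on T {x \<in> std_zeros (Suc n). R (T x)}"
        using bij_betw_imp_inj_on[OF bij] by (rule inj_on_subset) (auto simp: std_zeros_def)
      show "T ` {x \<in> std_zeros (Suc n). R (T x)} = {y \<in> vecs (Suc n). mat_form n U q y y = 0 \<and> R y}"
        using bij_betw_imp_surj_on[OF bij] by (auto simp: std_zeros_def T_norm simp flip: T_norm)
    qed
  qed
  show "card (std_zeros (Suc n)) = 1 + (q ^ 2 - 1) * card (rational_points (hermitian_variety q n U))"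
    using transport[of "\<lambda>_. True"] card_variety[of n U] by simp
  fix g :: "(nat \<Rightarrow> 'a) \<Rightarrow> 'a"
  assume g: "form_fun (Suc n) d g" "\<exists>x\<in>vecs (Suc n). g x \<noteq> 0" "d \<ge> 1"
  define a where "a j l = (if l < Suc n then mat_form n U q (unit_fun j) (b l) else 0)" for j l
  have inverse: "(\<lambda>l. \<Sum>j<Suc n. T x j * a j l) = x" if "x \<in> vecs (Suc n)" for x
  proof
    fix l
    show "(\<Sum>j<Suc n. T x j * a j l) = x l"
    proof (cases "l < Suc n")
      case True
      have "T x \<in> vecs (Suc n)" using bij that by (auto simp: bij_betw_def)
      then have "T x = (\<lambda>i. \<Sum>j<Suc n. T x j * unit_fun j i)"
        by (auto simp: fun_eq_iff vecs_def if_distrib[of "(*) _"] cong: if_cong)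
      then have "mat_form n U q (T x) (b l) = (\<Sum>j<Suc n. T x j * mat_form n U q (unit_fun j) (b l))"
        using B.sum_left[of "T x" unit_fun "{..<Suc n}" "b l"] by simp
      moreover have "mat_form n U q (T x) (b l) = x l"
        unfolding T_def by (rule B.orthonormal_coordinate[OF ortho True])
      ultimately show ?thesis using True by (simp only: a_def if_True)
    next
      case False
      then show ?thesis using that by (simp add: a_def vecs_def)
    qed
  qed
  obtain G where G: "is_form (Suc n) d G" "mpoly_fun G = (\<lambda>y. g (\<lambda>l. \<Sum>j<Suc n. y j * a j l))"
    using ex_mpoly_fun[OF form_fun_subst[OF g(1)]] by blast
  have GT: "mpoly_fun G (T x) = g x" if "x \<in> vecs (Suc n)" for x
    using inverse[OF that] by (simp add: G(2))
  have "G \<noteq> 0"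
    using g(2) GT by (auto simp: mpoly_fun_0)
  then have "nonzero_form n d G" using G(1) by (simp add: nonzero_form_iff)
  have "{x \<in> std_zeros (Suc n). g x = 0} = {x \<in> std_zeros (Suc n). mpoly_fun G (T x) = 0}"
    using GT by (auto simp: std_zeros_def)
  then have "card {x \<in> std_zeros (Suc n). g x = 0} =
      1 + (q ^ 2 - 1) * card (rational_points (hermitian_variety q n U \<inter> hypersurface n G))"
    using transport[of "\<lambda>y. mpoly_fun G y = 0"] card_section[OF G(1) g(3)] by simp
  also have "\<dots> \<le> 1 + (q ^ 2 - 1) * max_section q n d U"
    using card_section_le_max_section[OF \<open>nonzero_form n d G\<close> g(3)] by simp
  finally show "card {x \<in> std_zeros (Suc n). g x = 0} \<le> 1 + (q ^ 2 - 1) * max_section q n d U" .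
qed

text \<open>In coordinates x along an orthonormal system and t along the radical vector p, the
  Hermitian form no longer involves t. The f_k arise by expanding F along p and then substituting
  the orthonormal system.\<close>

lemma cone_section:
  fixes H :: "'a mat"
  assumes H: "hermitian_matrix q n H" "hermitian_rank n H = n"
    and F: "nonzero_form n d F" "1 \<le> d" "d \<le> q"
  obtains f where "\<And>k. form_fun n (d - k) (f k)" and "\<exists>k\<le>d. \<exists>x\<in>vecs n. f k x \<noteq> 0"
    and "card {(x, t). x \<in> std_zeros n \<and> (\<Sum>k\<le>d. f k x * t ^ k) = 0} =
      1 + (q ^ 2 - 1) * card (rational_points (hermitian_variety q n H \<inter> hypersurface n F))"
proof -
  interpret B: hermitian_form q K "Suc n" "mat_form n H q"
    by (rule hermitian_form_mat[OF H(1)])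
  have "card {y \<in> vecs (Suc n). \<forall>x\<in>vecs (Suc n). mat_form n H q x y = 0} \<le>
      card (UNIV :: 'a set) ^ (Suc n - n)"
    using card_radical_le[OF H(1)] H(2) by simp
  from B.ex_orthonormal[OF _ this le_refl] obtain b where
    b: "\<And>i. i < n \<Longrightarrow> b i \<in> vecs (Suc n)" and
    ortho: "\<And>i j. i < n \<Longrightarrow> j < n \<Longrightarrow> mat_form n H q (b i) (b j) = (if i = j then 1 else 0)"
    by (metis le_add2 plus_1_eq_Suc)
  obtain p where p: "p \<in> vecs (Suc n)" "p \<noteq> (\<lambda>_. 0)" "\<And>x. mat_form n H q x p = 0"
    using ex_radical_vector[OF H(1)] H(2) by auto
  define T where "T = (\<lambda>(x, t) l. (\<Sum>i<n. x i * b i l) + t * p l)"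
  have bij: "bij_betw T (vecs n \<times> UNIV) (vecs (Suc n))"
    unfolding T_def by (rule B.bij_betw_orthonormal_cone[OF refl ortho b p])
  have T_norm: "mat_form n H q (T (x, t)) (T (x, t)) = std_form n x x" for x t
    using B.orthonormal_std_form[OF ortho, of n x] q_ge_2 p(3)
    by (simp add: T_def B.norm_add power_0_left)
  have form: "is_form (Suc n) d F" "F \<noteq> 0" using F(1) by (auto simp: nonzero_form_iff)
  obtain g where g: "\<And>k. form_fun (Suc n) (d - k) (g k)"
    "\<And>x t. mpoly_fun F (\<lambda>i. x i + t * p i) = (\<Sum>k\<le>d. g k x * t ^ k)"
    by (rule form_fun_expand[OF form_fun_mpoly_fun[OF form(1)], of p]) blast
  define f where "f k x = g k (\<lambda>l. \<Sum>i<n. x i * b i l)" for k x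
  have FT: "mpoly_fun F (T (x, t)) = (\<Sum>k\<le>d. f k x * t ^ k)" for x t
    by (simp add: T_def g(2) f_def)
  show ?thesis
  proof (rule that)
    show "form_fun n (d - k) (f k)" for k
      using form_fun_subst[OF g(1)] unfolding f_def .
    \<comment> \<open>As d \<le> q < Q, the polynomial F is not the zero function, so not all
      coefficients f_k vanish as functions.\<close>
    have "q < q ^ 2" using q_ge_2 by (simp add: power2_eq_square)
    then obtain y where "y \<in> vecs (Suc n)" "mpoly_fun F y \<noteq> 0"
      using ex_mpoly_fun_nonzero[OF form] F(3) card_field by fastforce
    moreover from this obtain x t where "x \<in> vecs n" "y = T (x, t)"
      using bij_betw_imp_surj_on[OF bij] by fast
    ultimately show "\<exists>k\<le>d. \<exists>x\<in>vecs n. f k x \<noteq> 0"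
      using FT[of x t] by (metis (no_types, lifting) atMost_iff mult_eq_0_iff sum.neutral)
    have "card {(x, t). x \<in> std_zeros n \<and> (\<Sum>k\<le>d. f k x * t ^ k) = 0} =
        card {y \<in> vecs (Suc n). mat_form n H q y y = 0 \<and> mpoly_fun F y = 0}"
    proof (rule bij_betw_same_card[of T])
      show "bij_betw T {(x, t). x \<in> std_zeros n \<and> (\<Sum>k\<le>d. f k x * t ^ k) = 0}
        {y \<in> vecs (Suc n). mat_form n H q y y = 0 \<and> mpoly_fun F y = 0}"
        unfolding bij_betw_def
      proof
        show "inj_on T {(x, t). x \<in> std_zeros n \<and> (\<Sum>k\<le>d. f k x * t ^ k) = 0}"
          using bij_betw_imp_inj_on[OF bij] by (rule inj_on_subset) (auto simp: std_zeros_def)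
        have surj: "T ` (vecs n \<times> UNIV) = vecs (Suc n)" by (rule bij_betw_imp_surj_on[OF bij])
        show "T ` {(x, t). x \<in> std_zeros n \<and> (\<Sum>k\<le>d. f k x * t ^ k) = 0} =
          {y \<in> vecs (Suc n). mat_form n H q y y = 0 \<and> mpoly_fun F y = 0}"
          unfolding surj[symmetric] by (auto simp: std_zeros_def T_norm FT)
      qed
    qed
    also have "\<dots> = 1 + (q ^ 2 - 1) *
        card (rational_points (hermitian_variety q n H \<inter> hypersurface n F))"
      by (rule card_section[OF form(1) F(2)])
    finally show "card {(x, t). x \<in> std_zeros n \<and> (\<Sum>k\<le>d. f k x * t ^ k) = 0} = \<dots>" .
  qed
qed

end

theorem theorem3p3:
  fixes q n d :: nat
    and H U :: "'a::{finite, field} mat"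
    and P :: "'a alg_closure vec set"
    and F :: "'a mpoly"
  assumes "primepow q" and "card (UNIV :: 'a set) = q ^ 2"
    and "n \<ge> 3" and "1 \<le> d" and "d \<le> q"
    and "hermitian_matrix q n H" and "hermitian_rank n H = n"
    and "cone_vertex n (hermitian_variety q n H) P"
    and "hermitian_matrix q (n - 1) U" and "hermitian_rank (n - 1) U = n"
    and "nonzero_form n d F"
  shows "card (rational_points (hermitian_variety q n H \<inter> hypersurface n F))
    \<le> max (card (rational_points (hermitian_variety q (n - 1) U))
              + (d - 1) * (q + 1) * q ^ (2 * n - 4))
           (1 + q ^ 2 * max_section q (n - 1) d U)"
proof -
  interpret quadratic_field q "TYPE('a)"
    by standard (use assms in auto)
  have n: "Suc (n - 1) = n" using \<open>n \<ge> 3\<close> by simp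
  obtain f where f: "\<And>k. form_fun n (d - k) (f k)" "\<exists>k\<le>d. \<exists>x\<in>vecs n. f k x \<noteq> 0"
    "card {(x, t). x \<in> std_zeros n \<and> (\<Sum>k\<le>d. f k x * t ^ k) = 0} =
      1 + (q ^ 2 - 1) * card (rational_points (hermitian_variety q n H \<inter> hypersurface n F))"
    by (rule cone_section[OF assms(6,7,11,4,5)]) blast
  have U: "hermitian_rank (n - 1) U = Suc (n - 1)" using assms(10) n by simp
  note sections = nondegenerate_sections[OF assms(9) U, unfolded n]
  have "card (rational_points (hermitian_variety q n H \<inter> hypersurface n F))
    \<le> max (card (rational_points (hermitian_variety q (n - 1) U)) + (d - 1) * Suc q * (q ^ 2) ^ (n - 2))
        (1 + q ^ 2 * max_section q (n - 1) d U)"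
    by (rule card_cone_section_le[OF assms(3,4,5) f sections(1)])
      (rule sections(2)[OF _ _ assms(4)])
  also have "(q ^ 2) ^ (n - 2) = q ^ (2 * n - 4)"
    by (simp add: diff_mult_distrib2 flip: power_mult)
  finally show ?thesis by simp
qed

end
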